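(* Let $r,s>0$. Then there exists $(u,b,S,a)\in C_c^\infty(\mathbb{R}^3\times\mathbb{R};\mathbb{R}^3\times\mathbb{R}^3\times\mathcal{S}^{3\times3}\times\mathbb{R}^3)$ with $u\not\equiv0$ and $b\not\equiv0$ which is a strict subsolution of the 3D ideal MHD equations, i.e. $$\operatorname{div}u=\operatorname{div}b=0,\qquad \partial_tu+\operatorname{div}S=0,\qquad \partial_tb+\nabla\times a=0\quad\text{in }\mathbb{R}^3\times\mathbb{R},$$ and $(u,b,S,a)(x,t)\in\mathcal{U}_{r,s}$ for almost every $(x,t)\in\mathbb{R}^3\times\mathbb{R}$.
   Context: $\mathcal{S}^{3\times3}$ is the space of symmetric real $3\times3$ matrices; $(v\otimes w)_{ij}=v_iw_j$; $(\operatorname{div}M)_i=\sum_j\partial_jM_{ij}$. For $r,s>0$ let $K_{r,s}=\{(u,b,S,a)\in\mathbb{R}^3\times\mathbb{R}^3\times\mathcal{S}^{3\times3}\times\mathbb{R}^3: |u+b|=r,\ |u-b|=s,\ S=u\otimes u-b\otimes b+\Pi I \text{ for some }|\Pi|\le rs,\ a=b\times u\}$. Wave cone: $\Lambda$ is the set of $(u,b,S,a)\in\mathbb{R}^3\times\mathbb{R}^3\times\mathcal{S}^{3\times3}\times\mathbb{R}^3$ for which there is $(\xi,c)\in(\mathbb{R}^3\setminus\{0\})\times\mathbb{R}$ with $S\xi+cu=0$, $\xi\times a+cb=0$, $u\cdot\xi=b\cdot\xi=0$. Lamination convex hull: for a set $Y$ put $Y^{0,\Lambda}=Y$ and $Y^{N+1,\Lambda}=Y^{N,\Lambda}\cup\{\lambda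 V+(1-\lambda)W:\lambda\in[0,1],\ V,W\in Y^{N,\Lambda},\ V-W\in\Lambda\}$ for $N\ge0$; then $Y^{lc,\Lambda}=\bigcup_{N\ge0}Y^{N,\Lambda}$. $\mathcal{U}_{r,s}$ denotes the relative interior (interior in the subspace topology) of $K_{r,s}^{lc,\Lambda}$ in $\{(u,b,S,a)\in\mathbb{R}^3\times\mathbb{R}^3\times\mathcal{S}^{3\times3}\times\mathbb{R}^3: a\cdot b=0\}$. (Every element of $K_{r,s}^{lc,\Lambda}$ satisfies $a\cdot b=0$.) *)

theory Defs
  imports "HOL-Analysis.Analysis"
begin

text \<open>
  A state is a tuple \<open>(u, b, S, a)\<close>. The requirement that \<open>S\<close> be symmetric is not
  carried by the type; it is imposed in each set below and must be required separately of matrix fields.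
\<close>

type_synonym state = "(real^3) \<times> (real^3) \<times> (real^3^3) \<times> (real^3)"

definition symmetric_matrix :: "real^3^3 \<Rightarrow> bool" where
  "symmetric_matrix M \<longleftrightarrow> transpose M = M"

definition tensor :: "real^3 \<Rightarrow> real^3 \<Rightarrow> real^3^3" (infixr \<open>\<otimes>\<close> 75) where
  "v \<otimes> w = (\<chi> i j. v $ i * w $ j)"

definition K_set :: "real \<Rightarrow> real \<Rightarrow> state set" where
  "K_set r s = {(u, b, S, a). symmetric_matrix S \<and>
     norm (u + b) = r \<and> norm (u - b) = s \<and>
     (\<exists>P. \<bar>P\<bar> \<le> r * s \<and> S = u \<otimes> u - b \<otimes> b + P *\<^sub>R mat 1) \<and>
     a = cross3 b u}"

definition wave_cone :: "state set" where
  "wave_cone = {(u, b, S, a). symmetric_matrix S \<and>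
     (\<exists>\<xi> c. \<xi> \<noteq> 0 \<and> S *v \<xi> + c *\<^sub>R u = 0 \<and> cross3 \<xi> a + c *\<^sub>R b = 0 \<and>
        u \<bullet> \<xi> = 0 \<and> b \<bullet> \<xi> = 0)}"

primrec lamination :: "'a::real_vector set \<Rightarrow> 'a set \<Rightarrow> nat \<Rightarrow> 'a set" where
  "lamination \<Lambda> Y 0 = Y"
| "lamination \<Lambda> Y (Suc N) = lamination \<Lambda> Y N \<union>
     {l *\<^sub>R V + (1 - l) *\<^sub>R W | l V W. 0 \<le> l \<and> l \<le> 1 \<and>
        V \<in> lamination \<Lambda> Y N \<and> W \<in> lamination \<Lambda> Y N \<and> V - W \<in> \<Lambda>}"

definition lamination_hull :: "'a::real_vector set \<Rightarrow> 'a set \<Rightarrow> 'a set" where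
  "lamination_hull \<Lambda> Y = (\<Union>N. lamination \<Lambda> Y N)"

definition constraint_set :: "state set" where
  "constraint_set = {(u, b, S, a). symmetric_matrix S \<and> a \<bullet> b = 0}"

text \<open>
  The interior is taken in the subspace topology of \<open>constraint_set\<close>; this is unrelated
  to \<^const>\<open>rel_interior\<close>, which is relative to the affine hull.
\<close>

definition U_set :: "real \<Rightarrow> real \<Rightarrow> state set" where
  "U_set r s = (top_of_set constraint_set) interior_of (lamination_hull wave_cone (K_set r s))"

text \<open>
  \<open>C_k k f\<close>: all iterated directional derivatives of \<open>f\<close> up to order \<open>k\<close> exist and are
  continuous on the whole space.
\<close>

primrec C_k :: "nat \<Rightarrow> ('a::euclidean_space \<Rightarrow> 'b::real_normed_vector) \<Rightarrow> bool" where
  "C_k 0 f \<longleftrightarrow> continuous_on UNIV f"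
| "C_k (Suc k) f \<longleftrightarrow> (\<forall>p. f differentiable (at p)) \<and>
     (\<forall>v. C_k k (\<lambda>p. frechet_derivative f (at p) v))"

definition smooth :: "('a::euclidean_space \<Rightarrow> 'b::real_normed_vector) \<Rightarrow> bool" where
  "smooth f \<longleftrightarrow> (\<forall>k. C_k k f)"

definition compact_support :: "('a::euclidean_space \<Rightarrow> 'b::real_normed_vector) \<Rightarrow> bool" where
  "compact_support f \<longleftrightarrow> compact (closure {p. f p \<noteq> 0})"

text \<open>
  Points of space-time are pairs \<open>(x, t)\<close>. Partial derivatives are values of the total
  derivative on coordinate vectors; they are only applied to differentiable functions.
\<close>

type_synonym spacetime = "(real^3) \<times> real"

definition dx :: "3 \<Rightarrow> (spacetime \<Rightarrow> 'b::real_normed_vector) \<Rightarrow> spacetime \<Rightarrow> 'b" where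
  "dx j f p = frechet_derivative f (at p) (axis j 1, 0)"

definition dt :: "(spacetime \<Rightarrow> 'b::real_normed_vector) \<Rightarrow> spacetime \<Rightarrow> 'b" where
  "dt f p = frechet_derivative f (at p) (0, 1)"

definition div_vec :: "(spacetime \<Rightarrow> real^3) \<Rightarrow> spacetime \<Rightarrow> real" where
  "div_vec v p = (\<Sum>j\<in>UNIV. dx j (\<lambda>q. v q $ j) p)"

definition div_mat :: "(spacetime \<Rightarrow> real^3^3) \<Rightarrow> spacetime \<Rightarrow> real^3" where
  "div_mat M p = (\<chi> i. \<Sum>j\<in>UNIV. dx j (\<lambda>q. M q $ i $ j) p)"

definition curl :: "(spacetime \<Rightarrow> real^3) \<Rightarrow> spacetime \<Rightarrow> real^3" where
  "curl v p = vector
     [dx 2 (\<lambda>q. v q $ 3) p - dx 3 (\<lambda>q. v q $ 2) p,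
      dx 3 (\<lambda>q. v q $ 1) p - dx 1 (\<lambda>q. v q $ 3) p,
      dx 1 (\<lambda>q. v q $ 2) p - dx 2 (\<lambda>q. v q $ 1) p]"

definition linear_MHD ::
  "(spacetime \<Rightarrow> real^3) \<Rightarrow> (spacetime \<Rightarrow> real^3) \<Rightarrow> (spacetime \<Rightarrow> real^3^3) \<Rightarrow>
   (spacetime \<Rightarrow> real^3) \<Rightarrow> bool" where
  "linear_MHD u b S a \<longleftrightarrow>
     (\<forall>p. div_vec u p = 0 \<and> div_vec b p = 0 \<and>
          dt u p + div_mat S p = 0 \<and> dt b p + curl a p = 0)"

definition strict_subsolution ::
  "real \<Rightarrow> real \<Rightarrow> (spacetime \<Rightarrow> real^3) \<Rightarrow> (spacetime \<Rightarrow> real^3) \<Rightarrow>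
   (spacetime \<Rightarrow> real^3^3) \<Rightarrow> (spacetime \<Rightarrow> real^3) \<Rightarrow> bool" where
  "strict_subsolution r s u b S a \<longleftrightarrow> linear_MHD u b S a \<and>
     (AE p in lebesgue. (u p, b p, S p, a p) \<in> U_set r s)"

end

theory Submission
  imports Defs
begin

text \<open>
  Near \<open>0\<close> every state with \<open>a \<bullet> b = 0\<close> lies in the lamination hull, so it suffices to find a compactly
  supported solution of the linear system with \<open>a \<bullet> b = 0\<close> pointwise and to multiply it by a small
  constant. With a bump function \<open>g\<close> one can take
  \<open>u = (\<partial>\<^sub>1\<partial>\<^sub>2\<^sup>2 g, - \<partial>\<^sub>1\<^sup>2\<partial>\<^sub>2 g, 0)\<close>, \<open>S = diag (- \<partial>\<^sub>t\<partial>\<^sub>2\<^sup>2 g, \<partial>\<^sub>t\<partial>\<^sub>1\<^sup>2 g, 0)\<close>,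
  \<open>b = (0, \<partial>\<^sub>3 g, - \<partial>\<^sub>2 g)\<close> and \<open>a = (- \<partial>\<^sub>t g, 0, 0)\<close>.

  For the hull, a Galilean boost reduces to \<open>u = 0\<close>. Choose an orthonormal frame with \<open>a\<close> parallel to
  \<open>e1\<close> and \<open>b\<close> parallel to \<open>e3\<close>. Averages of four coplanar Elsasser vectors give all small \<open>(S, a)\<close> for
  which \<open>a\<close> is parallel to an eigenvector of \<open>S\<close> orthogonal to \<open>b\<close>. Averaging over two matrices
  \<open>S \<plusminus> D\<close> with \<open>D\<close> singular, and over turned frames, removes first the eigenvector condition and
  then the condition \<open>b \<bullet> S a = 0\<close>.
\<close>

subsection \<open>Tensors and the wave cone\<close>

lemma tensor_add_left: "(v + v') \<otimes> w = v \<otimes> w + v' \<otimes> w"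
  and tensor_add_right: "v \<otimes> (w + w') = v \<otimes> w + v \<otimes> w'"
  and tensor_diff_left: "(v - v') \<otimes> w = v \<otimes> w - v' \<otimes> w"
  and tensor_diff_right: "v \<otimes> (w - w') = v \<otimes> w - v \<otimes> w'"
  and tensor_scale_left: "(k *\<^sub>R v) \<otimes> w = k *\<^sub>R (v \<otimes> w)"
  and tensor_scale_right: "v \<otimes> (k *\<^sub>R w) = k *\<^sub>R (v \<otimes> w)"
  and tensor_minus_left: "(- v) \<otimes> w = - (v \<otimes> w)"
  and tensor_minus_right: "v \<otimes> (- w) = - (v \<otimes> w)"
  by (auto simp: tensor_def vec_eq_iff algebra_simps)

lemmas tensor_simps = tensor_add_left tensor_add_right tensor_diff_left tensor_diff_right
  tensor_scale_left tensor_scale_right tensor_minus_left tensor_minus_right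

lemma tensor_zero [simp]: "0 \<otimes> w = 0" "v \<otimes> 0 = 0"
  by (auto simp: tensor_def vec_eq_iff)

lemma transpose_tensor [simp]: "transpose (v \<otimes> w) = w \<otimes> v"
  by (auto simp: tensor_def transpose_def vec_eq_iff)

lemma transpose_plus: "transpose (A + B) = transpose A + transpose (B :: real^'n^'m)"
  and transpose_minus: "transpose (A - B) = transpose A - transpose (B :: real^'n^'m)"
  and transpose_uminus: "transpose (- A) = - transpose (A :: real^'n^'m)"
  and transpose_scale: "transpose (k *\<^sub>R A) = k *\<^sub>R transpose (A :: real^'n^'m)"
  by (auto simp: transpose_def vec_eq_iff)

lemmas symmetric_simps = symmetric_matrix_def transpose_plus transpose_minus transpose_uminus
  transpose_scale transpose_mat

lemma tensor_mult_vec: "(v \<otimes> w) *v x = (w \<bullet> x) *\<^sub>R v"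
  by (auto simp: tensor_def matrix_vector_mult_def inner_vec_def vec_eq_iff sum_distrib_left
      sum_distrib_right intro!: sum.cong)

lemma matrix_vector_mult_uminus_left: "(- A) *v x = - (A *v (x :: real^'n))"
  by (simp add: matrix_vector_mult_def vec_eq_iff sum_negf)

lemmas mult_vec_simps = matrix_vector_mult_add_rdistrib matrix_vector_mult_diff_rdistrib
  matrix_vector_mult_uminus_left scaleR_matrix_vector_assoc [symmetric] tensor_mult_vec
  matrix_vector_mul_lid

lemma inner_tensor: "S \<bullet> (v \<otimes> w) = v \<bullet> (S *v w)"
  by (simp add: inner_vec_def tensor_def matrix_vector_mult_def sum_distrib_left mult.left_commute)

lemma norm_tensor: "norm (v \<otimes> w) = norm v * norm w"
proof -
  have "(norm (v \<otimes> w))\<^sup>2 = (norm v * norm w)\<^sup>2"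
    by (simp add: power2_norm_eq_inner inner_tensor tensor_mult_vec power_mult_distrib)
  then show ?thesis
    by (simp add: power2_eq_iff_nonneg)
qed

lemma cross3_scale: "cross3 (k *\<^sub>R x) y = k *\<^sub>R cross3 x y" "cross3 x (k *\<^sub>R y) = k *\<^sub>R cross3 x y"
  by (simp_all add: cross_mult_left cross_mult_right)

lemmas cross3_bilinear_simps = cross_add_left cross_add_right Cross3.left_diff_distrib Cross3.right_diff_distrib
  cross_minus_left cross_minus_right cross3_scale

lemma wave_coneI:
  assumes "symmetric_matrix S" "\<xi> \<noteq> 0" "S *v \<xi> + c *\<^sub>R u = 0" "cross3 \<xi> a + c *\<^sub>R b = 0"
    "u \<bullet> \<xi> = 0" "b \<bullet> \<xi> = 0"
  shows "(u, b, S, a) \<in> wave_cone"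
  using assms by (auto simp: wave_cone_def)

lemma wave_cone_scaleR:
  assumes "D \<in> wave_cone"
  shows "k *\<^sub>R D \<in> wave_cone"
proof -
  obtain u b S a \<xi> c where D: "D = (u, b, S, a)" "symmetric_matrix S" "\<xi> \<noteq> 0"
    "S *v \<xi> + c *\<^sub>R u = 0" "cross3 \<xi> a + c *\<^sub>R b = 0" "u \<bullet> \<xi> = 0" "b \<bullet> \<xi> = 0"
    using assms by (auto simp: wave_cone_def)
  have "(k *\<^sub>R u, k *\<^sub>R b, k *\<^sub>R S, k *\<^sub>R a) \<in> wave_cone"
  proof (rule wave_coneI[where \<xi> = \<xi> and c = c])
    have "(k *\<^sub>R S) *v \<xi> + c *\<^sub>R k *\<^sub>R u = k *\<^sub>R (S *v \<xi> + c *\<^sub>R u)"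
      by (simp add: mult_vec_simps algebra_simps)
    then show "(k *\<^sub>R S) *v \<xi> + c *\<^sub>R k *\<^sub>R u = 0" using D by simp
    have "cross3 \<xi> (k *\<^sub>R a) + c *\<^sub>R k *\<^sub>R b = k *\<^sub>R (cross3 \<xi> a + c *\<^sub>R b)"
      by (simp add: cross3_scale algebra_simps)
    then show "cross3 \<xi> (k *\<^sub>R a) + c *\<^sub>R k *\<^sub>R b = 0" using D by simp
  qed (use D in \<open>auto simp: symmetric_simps\<close>)
  then show ?thesis using D by simp
qed

section \<open>Midpoint-closed sets and Elsasser points of the hull\<close>

definition mid_closed :: "state set \<Rightarrow> bool" where
  "mid_closed H \<longleftrightarrow> (\<forall>X D. D \<in> wave_cone \<longrightarrow> X + D \<in> H \<longrightarrow> X - D \<in> H \<longrightarrow> X \<in> H)"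

lemma mid_closedD:
  assumes "mid_closed H" "D \<in> wave_cone" "X + D \<in> H" "X - D \<in> H"
  shows "X \<in> H"
  using assms unfolding mid_closed_def by blast

lemma lamination_mono: "M \<le> N \<Longrightarrow> lamination \<Lambda> Y M \<subseteq> lamination \<Lambda> Y N"
  by (rule lift_Suc_mono_le) auto

text \<open>Both endpoints lie in a common lamination level, and the cone is closed under scaling,
  so the full difference \<open>2 *\<^sub>R D\<close> belongs to it. Later arguments use wave-cone
  segments only through their midpoints.\<close>

lemma mid_closed_lamination_hull: "mid_closed (lamination_hull wave_cone Y)"
  unfolding mid_closed_def
proof (intro allI impI)
  fix X D :: state
  assume D: "D \<in> wave_cone" and "X + D \<in> lamination_hull wave_cone Y"
    "X - D \<in> lamination_hull wave_cone Y"
  then obtain M N where "X + D \<in> lamination wave_cone Y M" "X - D \<in> lamination wave_cone Y N"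
    by (auto simp: lamination_hull_def)
  then have XD: "X + D \<in> lamination wave_cone Y (max M N)" "X - D \<in> lamination wave_cone Y (max M N)"
    using lamination_mono[of M "max M N" wave_cone Y] lamination_mono[of N "max M N" wave_cone Y] by auto
  have "(X + D) - (X - D) = 2 *\<^sub>R D"
    by (simp add: scaleR_2)
  then have "(X + D) - (X - D) \<in> wave_cone"
    using wave_cone_scaleR[OF D] by simp
  moreover have "X = (1/2::real) *\<^sub>R (X + D) + (1 - 1/2) *\<^sub>R (X - D)"
    by (simp add: algebra_simps flip: scaleR_add_left)
  ultimately have "X \<in> lamination wave_cone Y (Suc (max M N))"
    using XD unfolding lamination.simps
    by (intro UnI2 CollectI exI[of _ "1/2 :: real"] exI[of _ "X + D"] exI[of _ "X - D"]) auto
  then show "X \<in> lamination_hull wave_cone Y"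
    unfolding lamination_hull_def by blast
qed

text \<open>
  The point of \<open>K\<close> with Elsasser variables \<open>p = u + b\<close>, \<open>q = u - b\<close>; the spheres in the definition
  of \<open>K\<close> constrain \<open>p\<close> and \<open>q\<close> separately.
\<close>

definition elsasser :: "real^3 \<Rightarrow> real^3 \<Rightarrow> real \<Rightarrow> state" where
  "elsasser p q P = ((1/2) *\<^sub>R (p + q), (1/2) *\<^sub>R (p - q),
     (1/2) *\<^sub>R (p \<otimes> q + q \<otimes> p) + P *\<^sub>R mat 1, (1/2) *\<^sub>R cross3 p q)"

lemma half_add_half: "(1/2::real) *\<^sub>R x + (1/2::real) *\<^sub>R x = (x :: 'a::real_vector)"
  by (simp only: scaleR_add_left [symmetric]) simp

text \<open>Expanding in \<open>u\<close> and \<open>b\<close>, half of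
  \<open>p \<otimes> q + q \<otimes> p\<close> is \<open>u \<otimes> u - b \<otimes> b\<close>, and
  half of \<open>cross3 p q\<close> is \<open>cross3 b u\<close>.\<close>

lemma elsasser_in_K_set:
  assumes "norm p = r" "norm q = s" "\<bar>P\<bar> \<le> r * s"
  shows "elsasser p q P \<in> K_set r s"
proof -
  define u b where "u = (1/2::real) *\<^sub>R (p + q)" and "b = (1/2::real) *\<^sub>R (p - q)"
  have p: "p = u + b" and q: "q = u - b"
    by (auto simp: u_def b_def algebra_simps half_add_half)
  have "(1/2) *\<^sub>R (p \<otimes> q + q \<otimes> p) = u \<otimes> u - b \<otimes> b"
    unfolding p q by (simp add: tensor_def vec_eq_iff field_simps)
  moreover have "(1/2) *\<^sub>R cross3 p q = cross3 b u"
    unfolding p q using cross_skew[of u b]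
    by (simp add: cross3_bilinear_simps cross_refl flip: scaleR_2)
  ultimately have "elsasser p q P = (u, b, u \<otimes> u - b \<otimes> b + P *\<^sub>R mat 1, cross3 b u)"
    by (simp add: elsasser_def u_def b_def)
  moreover have "symmetric_matrix (u \<otimes> u - b \<otimes> b + P *\<^sub>R mat 1)"
    by (simp add: symmetric_simps)
  ultimately show ?thesis
    using assms p q by (auto simp: K_set_def)
qed

lemma exists_orthogonal_of_norm:
  fixes p :: "real^3"
  assumes "k \<ge> 0"
  shows "\<exists>d. p \<bullet> d = 0 \<and> norm d = k"
proof -
  obtain y where y: "y \<noteq> 0" "orthogonal p y"
    using orthogonal_to_vector_exists[of p] by auto
  show ?thesis
    using y assms by (intro exI[of _ "(k / norm y) *\<^sub>R y"]) (auto simp: orthogonal_def)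
qed

text \<open>A chord through \<open>p\<close> perpendicular to \<open>p\<close> is bisected by
  \<open>p\<close>; its half-length comes from Pythagoras. This is how spheres are filled to closed
  balls.\<close>

lemma exists_sphere_chord:
  fixes p :: "real^3"
  assumes "norm p \<le> r"
  shows "\<exists>d. norm (p + d) = r \<and> norm (p - d) = r"
proof -
  have r: "r \<ge> 0" "(norm p)\<^sup>2 \<le> r\<^sup>2"
    using assms norm_ge_zero[of p] by (auto intro: order_trans power_mono simp del: norm_ge_zero)
  obtain d where d: "p \<bullet> d = 0" "norm d = sqrt (r\<^sup>2 - (norm p)\<^sup>2)"
    using exists_orthogonal_of_norm[of "sqrt (r\<^sup>2 - (norm p)\<^sup>2)" p] r by auto
  have dd: "(norm d)\<^sup>2 = r\<^sup>2 - (norm p)\<^sup>2"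
    using d r by simp
  have "(norm (p + d))\<^sup>2 = r\<^sup>2" "(norm (p - d))\<^sup>2 = r\<^sup>2"
    using d(1) dd by (simp_all add: power2_norm_eq_inner inner_simps inner_commute)
  then show ?thesis
    using r by (intro exI[of _ d]) (simp add: power2_eq_iff_nonneg)
qed

text \<open>For fixed \<open>q\<close> and \<open>P\<close> the Elsasser point is affine in
  \<open>p\<close>. Its direction is in the cone for any \<open>\<xi>\<close> orthogonal to
  \<open>d\<close>: both \<open>S *v \<xi>\<close> and \<open>cross3 \<xi> a\<close> then reduce to
  \<open>q \<bullet> \<xi>\<close> times the \<open>u\<close> and \<open>b\<close> components, which
  \<open>c\<close> cancels.\<close>

lemma elsasser_left_in_mid_closed:
  assumes H: "mid_closed H" and "elsasser (p + d) q P \<in> H" "elsasser (p - d) q P \<in> H"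
  shows "elsasser p q P \<in> H"
proof -
  define D where "D = ((1/2) *\<^sub>R d, (1/2) *\<^sub>R d, (1/2) *\<^sub>R (d \<otimes> q + q \<otimes> d), (1/2) *\<^sub>R cross3 d q)"
  obtain \<xi> where \<xi>: "d \<bullet> \<xi> = 0" "norm \<xi> = 1"
    using exists_orthogonal_of_norm[of 1 d] by auto
  have "D \<in> wave_cone"
    unfolding D_def
  proof (rule wave_coneI[where \<xi> = \<xi> and c = "- (q \<bullet> \<xi>)"])
    show "cross3 \<xi> ((1/2) *\<^sub>R cross3 d q) + - (q \<bullet> \<xi>) *\<^sub>R (1/2) *\<^sub>R d = 0"
      using \<xi> by (simp add: cross3_scale Lagrange inner_commute algebra_simps)
  qed (use \<xi> in \<open>auto simp: symmetric_simps mult_vec_simps algebra_simps\<close>)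
  moreover have "elsasser p q P + D = elsasser (p + d) q P" "elsasser p q P - D = elsasser (p - d) q P"
    by (simp_all add: elsasser_def D_def tensor_simps cross3_bilinear_simps algebra_simps)
  ultimately show ?thesis
    using mid_closedD[OF H] assms by metis
qed

lemma elsasser_right_in_mid_closed:
  assumes H: "mid_closed H" and "elsasser p (q + d) P \<in> H" "elsasser p (q - d) P \<in> H"
  shows "elsasser p q P \<in> H"
proof -
  define D where "D = ((1/2) *\<^sub>R d, - (1/2) *\<^sub>R d, (1/2) *\<^sub>R (p \<otimes> d + d \<otimes> p), (1/2) *\<^sub>R cross3 p d)"
  obtain \<xi> where \<xi>: "d \<bullet> \<xi> = 0" "norm \<xi> = 1"
    using exists_orthogonal_of_norm[of 1 d] by auto
  have "D \<in> wave_cone"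
    unfolding D_def
  proof (rule wave_coneI[where \<xi> = \<xi> and c = "- (p \<bullet> \<xi>)"])
    show "cross3 \<xi> ((1/2) *\<^sub>R cross3 p d) + - (p \<bullet> \<xi>) *\<^sub>R - (1/2) *\<^sub>R d = 0"
      using \<xi> by (simp add: cross3_scale Lagrange inner_commute algebra_simps)
  qed (use \<xi> in \<open>auto simp: symmetric_simps mult_vec_simps algebra_simps\<close>)
  moreover have "elsasser p q P + D = elsasser p (q + d) P" "elsasser p q P - D = elsasser p (q - d) P"
    by (simp_all add: elsasser_def D_def tensor_simps cross3_bilinear_simps algebra_simps)
  ultimately show ?thesis
    using mid_closedD[OF H] assms by metis
qed

text \<open>Two successive chords, first in \<open>p\<close> and then in \<open>q\<close>, reduce
  the point to four points of \<open>K_set r s\<close>.\<close>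

lemma elsasser_in_hull:
  assumes "norm p \<le> r" "norm q \<le> s" "\<bar>P\<bar> \<le> r * s"
  shows "elsasser p q P \<in> lamination_hull wave_cone (K_set r s)"
proof -
  have sub: "K_set r s \<subseteq> lamination_hull wave_cone (K_set r s)"
    unfolding lamination_hull_def using lamination.simps(1) by blast
  note mc = mid_closed_lamination_hull[of "K_set r s"]
  obtain d e where "norm (p + d) = r" "norm (p - d) = r" "norm (q + e) = s" "norm (q - e) = s"
    using exists_sphere_chord assms by metis
  then show ?thesis
    using assms(3) sub
    by (intro elsasser_left_in_mid_closed[OF mc, of p d] elsasser_right_in_mid_closed[OF mc, of _ q e])
      (auto intro!: elsasser_in_K_set subsetD[OF sub])
qed

text \<open>
  Galilean boost by \<open>v\<close> composed with the dilation by \<open>\<rho>\<close>. Its linear part preserves the wave cone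
  (replace \<open>c\<close> by \<open>\<rho> c - v \<bullet> \<xi>\<close>), which reduces everything to \<open>u = 0\<close> and unit balls.
\<close>

definition galilei :: "real^3 \<Rightarrow> real \<Rightarrow> state \<Rightarrow> state" where
  "galilei v \<rho> = (\<lambda>(u, b, S, a). (v + \<rho> *\<^sub>R u, \<rho> *\<^sub>R b,
     v \<otimes> v + \<rho> *\<^sub>R (v \<otimes> u + u \<otimes> v) + \<rho>\<^sup>2 *\<^sub>R S, \<rho>\<^sup>2 *\<^sub>R a + \<rho> *\<^sub>R cross3 b v))"

lemma galilei_els: "galilei v \<rho> (elsasser p q P) = elsasser (v + \<rho> *\<^sub>R p) (v + \<rho> *\<^sub>R q) (\<rho>\<^sup>2 * P)"
  using half_add_half[of v] half_add_half[of "v \<otimes> v"] cross_skew[of v q]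
  by (simp add: galilei_def elsasser_def tensor_simps cross3_bilinear_simps cross_refl power2_eq_square algebra_simps)

lemma mid_closed_galilei:
  assumes H: "mid_closed H"
  shows "mid_closed (galilei v \<rho> -` H)"
  unfolding mid_closed_def
proof (intro allI impI)
  fix X D assume D: "D \<in> wave_cone" and X: "X + D \<in> galilei v \<rho> -` H" "X - D \<in> galilei v \<rho> -` H"
  obtain u b S a \<xi> c where D: "D = (u, b, S, a)" "symmetric_matrix S" "\<xi> \<noteq> 0"
    "S *v \<xi> + c *\<^sub>R u = 0" "cross3 \<xi> a + c *\<^sub>R b = 0" "u \<bullet> \<xi> = 0" "b \<bullet> \<xi> = 0"
    using D by (auto simp: wave_cone_def)
  \<comment> \<open>The linear part of the affine map \<open>galilei v \<rho>\<close> applied to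
    \<open>D\<close>.\<close>
  define D' where "D' = (\<rho> *\<^sub>R u, \<rho> *\<^sub>R b, \<rho> *\<^sub>R (v \<otimes> u + u \<otimes> v) + \<rho>\<^sup>2 *\<^sub>R S, \<rho>\<^sup>2 *\<^sub>R a + \<rho> *\<^sub>R cross3 b v)"
  have *: "S *v \<xi> = - c *\<^sub>R u" "cross3 \<xi> a = - c *\<^sub>R b"
    using D by (simp_all add: eq_neg_iff_add_eq_0)
  have "D' \<in> wave_cone"
    unfolding D'_def
  proof (rule wave_coneI[where \<xi> = \<xi> and c = "\<rho> * c - v \<bullet> \<xi>"])
    show "(\<rho> *\<^sub>R (v \<otimes> u + u \<otimes> v) + \<rho>\<^sup>2 *\<^sub>R S) *v \<xi> + (\<rho> * c - v \<bullet> \<xi>) *\<^sub>R \<rho> *\<^sub>R u = 0"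
      using D * by (simp add: mult_vec_simps algebra_simps power2_eq_square)
    show "cross3 \<xi> (\<rho>\<^sup>2 *\<^sub>R a + \<rho> *\<^sub>R cross3 b v) + (\<rho> * c - v \<bullet> \<xi>) *\<^sub>R \<rho> *\<^sub>R b = 0"
      using D * by (simp add: cross3_bilinear_simps Lagrange inner_commute algebra_simps power2_eq_square)
  qed (use D in \<open>auto simp: symmetric_simps algebra_simps\<close>)
  moreover have "galilei v \<rho> (X + D) = galilei v \<rho> X + D'" "galilei v \<rho> (X - D) = galilei v \<rho> X - D'"
    by (cases X; simp add: D(1) D'_def galilei_def tensor_simps cross3_bilinear_simps scaleR_add_right scaleR_diff_right)+
  ultimately show "X \<in> galilei v \<rho> -` H"
    using mid_closedD[OF H, of D' "galilei v \<rho> X"] X by simp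
qed

subsection \<open>Orthonormal frames\<close>

definition frame :: "real^3 \<Rightarrow> real^3 \<Rightarrow> real^3 \<Rightarrow> bool" where
  "frame e1 e2 e3 \<longleftrightarrow> e1 \<bullet> e1 = 1 \<and> e2 \<bullet> e2 = 1 \<and> e3 \<bullet> e3 = 1 \<and>
     e1 \<bullet> e2 = 0 \<and> e1 \<bullet> e3 = 0 \<and> e2 \<bullet> e3 = 0 \<and>
     cross3 e1 e2 = e3 \<and> cross3 e2 e3 = e1 \<and> cross3 e3 e1 = e2"

lemma frameD:
  assumes "frame e1 e2 e3"
  shows "e1 \<bullet> e1 = 1" "e2 \<bullet> e2 = 1" "e3 \<bullet> e3 = 1"
    "e1 \<bullet> e2 = 0" "e1 \<bullet> e3 = 0" "e2 \<bullet> e3 = 0" "e2 \<bullet> e1 = 0" "e3 \<bullet> e1 = 0" "e3 \<bullet> e2 = 0"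
    "cross3 e1 e2 = e3" "cross3 e2 e3 = e1" "cross3 e3 e1 = e2"
    "cross3 e2 e1 = - e3" "cross3 e3 e2 = - e1" "cross3 e1 e3 = - e2"
    "norm e1 = 1" "norm e2 = 1" "norm e3 = 1"
  using assms cross_skew[of e2 e1] cross_skew[of e3 e2] cross_skew[of e1 e3]
  by (auto simp: frame_def inner_commute norm_eq_sqrt_inner)

lemma frame_cross3:
  assumes "norm e1 = 1" "norm e3 = 1" "e1 \<bullet> e3 = 0"
  shows "frame e1 (cross3 e3 e1) e3"
proof -
  have *: "e1 \<bullet> e1 = 1" "e3 \<bullet> e3 = 1" "e3 \<bullet> e1 = 0"
    using assms by (auto simp: norm_eq_1 inner_commute)
  have c: "cross3 e1 (cross3 e3 e1) = e3" "cross3 (cross3 e3 e1) e3 = e1"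
    using * assms Lagrange[of e1 e3 e1] Lagrange[of e3 e3 e1] cross_skew[of "cross3 e3 e1" e3] by auto
  have "cross3 e3 e1 \<bullet> cross3 e3 e1 = 1"
    using * assms norm_cross[of e3 e1] by (simp add: power2_norm_eq_inner)
  moreover have "e1 \<bullet> cross3 e3 e1 = 0" "cross3 e3 e1 \<bullet> e3 = 0"
    by (simp_all add: dot_cross_self)
  ultimately show ?thesis
    using * c assms unfolding frame_def by simp
qed

lemma frame_quarter_turn:
  assumes "frame e1 e2 e3"
  shows "frame e2 (- e1) e3"
  by (simp add: frame_def frameD[OF assms])

lemma frame_eighth_turn:
  assumes "frame e1 e2 e3" "c * c = 1/2"
  shows "frame (c *\<^sub>R (e1 + e2)) (c *\<^sub>R (e2 - e1)) e3"
proof -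
  have cc: "c * 2 * c = 1" "c * c * 2 = 1"
    using assms(2) by auto
  show ?thesis
    by (simp add: cc frame_def frameD[OF assms(1)] inner_simps cross3_bilinear_simps scaleR_2 [symmetric]
        flip: mult.assoc)
qed

lemma frame_expand:
  assumes "frame e1 e2 e3"
  shows "x = (e1 \<bullet> x) *\<^sub>R e1 + (e2 \<bullet> x) *\<^sub>R e2 + (e3 \<bullet> x) *\<^sub>R e3"
proof -
  note f = frameD[OF assms]
  define y where "y = x - ((e1 \<bullet> x) *\<^sub>R e1 + (e2 \<bullet> x) *\<^sub>R e2 + (e3 \<bullet> x) *\<^sub>R e3)"
  have y: "e1 \<bullet> y = 0" "e2 \<bullet> y = 0" "e3 \<bullet> y = 0"
    by (simp_all add: y_def inner_simps f)
  \<comment> \<open>The triple product with \<open>e3 = cross3 e1 e2\<close> expands into multiples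
    of \<open>y \<bullet> e1\<close> and \<open>y \<bullet> e2\<close>. Since \<open>y\<close> is
    also orthogonal to \<open>e3\<close>, \<open>cross3 e3 (cross3 y e3)\<close> recovers
    \<open>y\<close>.\<close>
  have "cross3 y e3 = 0"
    using Lagrange[of y e1 e2] y by (simp add: f inner_commute)
  then have "y = 0"
    using Lagrange[of e3 y e3] y by (simp add: f)
  then show ?thesis
    by (simp add: y_def)
qed

section \<open>Symmetric matrices in frame coordinates\<close>

definition frame_mat :: "real^3 \<Rightarrow> real^3 \<Rightarrow> real^3 \<Rightarrow> real \<Rightarrow> real \<Rightarrow> real \<Rightarrow> real \<Rightarrow> real \<Rightarrow> real \<Rightarrow> real^3^3" where
  "frame_mat e1 e2 e3 x11 x22 x33 x12 x13 x23 =
     x11 *\<^sub>R (e1 \<otimes> e1) + x22 *\<^sub>R (e2 \<otimes> e2) + x33 *\<^sub>R (e3 \<otimes> e3) + x12 *\<^sub>R (e1 \<otimes> e2 + e2 \<otimes> e1) +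
     x13 *\<^sub>R (e1 \<otimes> e3 + e3 \<otimes> e1) + x23 *\<^sub>R (e2 \<otimes> e3 + e3 \<otimes> e2)"

lemma symmetric_frame_mat [simp]: "symmetric_matrix (frame_mat e1 e2 e3 x11 x22 x33 x12 x13 x23)"
  by (simp add: frame_mat_def symmetric_simps add_ac)

lemma frame_mat_add: "frame_mat e1 e2 e3 x11 x22 x33 x12 x13 x23 + frame_mat e1 e2 e3 y11 y22 y33 y12 y13 y23 =
    frame_mat e1 e2 e3 (x11 + y11) (x22 + y22) (x33 + y33) (x12 + y12) (x13 + y13) (x23 + y23)"
  by (simp add: frame_mat_def scaleR_add_left)

lemma frame_mat_diff: "frame_mat e1 e2 e3 x11 x22 x33 x12 x13 x23 - frame_mat e1 e2 e3 y11 y22 y33 y12 y13 y23 =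
    frame_mat e1 e2 e3 (x11 - y11) (x22 - y22) (x33 - y33) (x12 - y12) (x13 - y13) (x23 - y23)"
  by (simp add: frame_mat_def scaleR_diff_left)

lemma frame_mat_mult_vec:
  assumes "frame e1 e2 e3"
  shows "frame_mat e1 e2 e3 x11 x22 x33 x12 x13 x23 *v (k1 *\<^sub>R e1 + k2 *\<^sub>R e2 + k3 *\<^sub>R e3) =
    (x11 * k1 + x12 * k2 + x13 * k3) *\<^sub>R e1 + (x12 * k1 + x22 * k2 + x23 * k3) *\<^sub>R e2 +
    (x13 * k1 + x23 * k2 + x33 * k3) *\<^sub>R e3"
  by (simp add: frame_mat_def mult_vec_simps inner_simps frameD[OF assms] scaleR_add_left scaleR_add_right)

lemma frame_mat_mult_frame:
  assumes "frame e1 e2 e3"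
  shows "frame_mat e1 e2 e3 x11 x22 x33 x12 x13 x23 *v e1 = x11 *\<^sub>R e1 + x12 *\<^sub>R e2 + x13 *\<^sub>R e3"
    "frame_mat e1 e2 e3 x11 x22 x33 x12 x13 x23 *v e2 = x12 *\<^sub>R e1 + x22 *\<^sub>R e2 + x23 *\<^sub>R e3"
    "frame_mat e1 e2 e3 x11 x22 x33 x12 x13 x23 *v e3 = x13 *\<^sub>R e1 + x23 *\<^sub>R e2 + x33 *\<^sub>R e3"
  using frame_mat_mult_vec[OF assms, where ?k1.0=1 and ?k2.0=0 and ?k3.0=0]
    frame_mat_mult_vec[OF assms, where ?k1.0=0 and ?k2.0=1 and ?k3.0=0]
    frame_mat_mult_vec[OF assms, where ?k1.0=0 and ?k2.0=0 and ?k3.0=1] by simp_all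

text \<open>Both matrices agree on the three frame vectors, symmetry supplying the entries below the
  diagonal; linearity and \<open>frame_expand\<close> do the rest.\<close>

lemma symmetric_eq_frame_mat:
  assumes f: "frame e1 e2 e3" and S: "symmetric_matrix S"
  shows "S = frame_mat e1 e2 e3 (e1 \<bullet> (S *v e1)) (e2 \<bullet> (S *v e2)) (e3 \<bullet> (S *v e3))
    (e1 \<bullet> (S *v e2)) (e1 \<bullet> (S *v e3)) (e2 \<bullet> (S *v e3))" (is "S = ?R")
proof -
  have sym: "v \<bullet> (S *v w) = w \<bullet> (S *v v)" for v w
    using S dot_lmul_matrix[of v S w] by (simp add: symmetric_matrix_def inner_commute
        flip: transpose_matrix_vector)
  have "S *v x = ?R *v x" for x
  proof -
    define k1 k2 k3 where "k1 = e1 \<bullet> x" and "k2 = e2 \<bullet> x" and "k3 = e3 \<bullet> x"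
    have x: "x = k1 *\<^sub>R e1 + k2 *\<^sub>R e2 + k3 *\<^sub>R e3"
      unfolding k1_def k2_def k3_def by (rule frame_expand[OF f])
    have S1: "S *v e1 = (e1 \<bullet> (S *v e1)) *\<^sub>R e1 + (e1 \<bullet> (S *v e2)) *\<^sub>R e2 + (e1 \<bullet> (S *v e3)) *\<^sub>R e3"
      using frame_expand[OF f, of "S *v e1"] by (simp only: sym[of e2 e1] sym[of e3 e1])
    have S2: "S *v e2 = (e1 \<bullet> (S *v e2)) *\<^sub>R e1 + (e2 \<bullet> (S *v e2)) *\<^sub>R e2 + (e2 \<bullet> (S *v e3)) *\<^sub>R e3"
      using frame_expand[OF f, of "S *v e2"] by (simp only: sym[of e3 e2])
    have S3: "S *v e3 = (e1 \<bullet> (S *v e3)) *\<^sub>R e1 + (e2 \<bullet> (S *v e3)) *\<^sub>R e2 + (e3 \<bullet> (S *v e3)) *\<^sub>R e3"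
      using frame_expand[OF f, of "S *v e3"] .
    have "S *v x = k1 *\<^sub>R (S *v e1) + k2 *\<^sub>R (S *v e2) + k3 *\<^sub>R (S *v e3)"
      unfolding x by (simp add: matrix_vector_right_distrib matrix_vector_mult_scaleR)
    also have "\<dots> = k1 *\<^sub>R (?R *v e1) + k2 *\<^sub>R (?R *v e2) + k3 *\<^sub>R (?R *v e3)"
      unfolding frame_mat_mult_frame[OF f] S1[symmetric] S2[symmetric] S3[symmetric] by (rule refl)
    also have "\<dots> = ?R *v x"
      unfolding x by (simp only: matrix_vector_right_distrib matrix_vector_mult_scaleR)
    finally show ?thesis .
  qed
  then show ?thesis
    unfolding matrix_eq by blast
qed

lemma mat_1_eq_frame_mat: "frame e1 e2 e3 \<Longrightarrow> mat 1 = frame_mat e1 e2 e3 1 1 1 0 0 0"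
  using symmetric_eq_frame_mat[of e1 e2 e3 "mat 1"] by (simp add: symmetric_simps frameD)

text \<open>Translates a matrix from the frame turned by a quarter about \<open>e3\<close> back to
  the original frame.\<close>

lemma frame_mat_minus_frame: "frame_mat e2 (- e1) e3 x22 x11 x33 y12 y23 y13 = frame_mat e1 e2 e3 x11 x22 x33 (- y12) (- y13) y23"
  by (simp add: frame_mat_def tensor_def vec_eq_iff field_simps)

section \<open>Averaging at zero velocity\<close>

lemma mid_closed_fixed:
  assumes "mid_closed H" "(u, b, S1, a1) \<in> H" "(u, b, S2, a2) \<in> H"
    "S1 = S + D" "S2 = S - D" "a1 = a + \<delta>" "a2 = a - \<delta>"
    "symmetric_matrix D" "\<xi> \<noteq> 0" "D *v \<xi> = 0" "cross3 \<xi> \<delta> = 0"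
  shows "(u, b, S, a) \<in> H"
proof (rule mid_closedD[OF assms(1)])
  \<comment> \<open>With zero \<open>u\<close> and \<open>b\<close> components the cone condition
    asks only for a kernel vector of \<open>D\<close> that is parallel to
    \<open>\<delta>\<close>.\<close>
  show "(0, 0, D, \<delta>) \<in> wave_cone"
    using assms by (intro wave_coneI[where \<xi> = \<xi> and c = 0]) auto
qed (use assms in auto)

text \<open>Abstracts from the radii and the boost: after rescaling, both Elsasser variables range
  over the unit ball.\<close>

definition unit_good :: "state set \<Rightarrow> bool" where
  "unit_good H \<longleftrightarrow> mid_closed H \<and>
     (\<forall>p q P. norm p \<le> 1 \<longrightarrow> norm q \<le> 1 \<longrightarrow> \<bar>P\<bar> \<le> 1 \<longrightarrow> elsasser p q P \<in> H)"

text \<open>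
  The points are \<open>p = b \<plusminus> d\<close>, \<open>q = - b \<plusminus> e\<close>: the four vectors lie in the plane orthogonal to \<open>e1\<close>, which
  is why the difference is in the wave cone.
\<close>

lemma unit_good_rank_one:
  assumes H: "unit_good H" and f: "frame e1 e2 e3" and "\<bar>\<beta>\<bar> \<le> 1/2" "\<bar>P\<bar> \<le> 1"
    and de: "norm d \<le> 1/2" "norm e \<le> 1/2" "d \<bullet> e1 = 0" "e \<bullet> e1 = 0"
  shows "(0, \<beta> *\<^sub>R e3, (1/2) *\<^sub>R (d \<otimes> e + e \<otimes> d) - (\<beta> * \<beta>) *\<^sub>R (e3 \<otimes> e3) + P *\<^sub>R mat 1,
    (1/2) *\<^sub>R cross3 d e) \<in> H"
proof -
  define b where "b = \<beta> *\<^sub>R e3"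
  note fD = frameD[OF f]
  have nb: "norm b \<le> 1/2" "b \<bullet> e1 = 0"
    using assms by (auto simp: b_def fD)
  define D where "D = ((1/2) *\<^sub>R (d + e), (1/2) *\<^sub>R (d - e),
      (1/2) *\<^sub>R (b \<otimes> (e - d) + (e - d) \<otimes> b), (1/2) *\<^sub>R cross3 b (d + e))"
  have "D \<in> wave_cone"
    unfolding D_def
    using nb de fD by (intro wave_coneI[where \<xi> = e1 and c = 0])
      (auto simp: symmetric_simps mult_vec_simps inner_simps Lagrange cross3_scale inner_commute)
  moreover have "(0, b, (1/2) *\<^sub>R (d \<otimes> e + e \<otimes> d) - b \<otimes> b + P *\<^sub>R mat 1, (1/2) *\<^sub>R cross3 d e) + D
     = elsasser (b + d) (- b + e) P"
    using cross_skew[of d b]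
    by (simp add: elsasser_def D_def tensor_simps cross3_bilinear_simps) (simp add: vec_eq_iff field_simps)
  moreover have "(0, b, (1/2) *\<^sub>R (d \<otimes> e + e \<otimes> d) - b \<otimes> b + P *\<^sub>R mat 1, (1/2) *\<^sub>R cross3 d e) - D
     = elsasser (b - d) (- b - e) P"
    using cross_skew[of d b]
    by (simp add: elsasser_def D_def tensor_simps cross3_bilinear_simps) (simp add: vec_eq_iff field_simps)
  moreover have "elsasser (b + d) (- b + e) P \<in> H" "elsasser (b - d) (- b - e) P \<in> H"
  proof -
    have "norm (b + d) \<le> 1" "norm (- b + e) \<le> 1" "norm (b - d) \<le> 1" "norm (- b - e) \<le> 1"
      using nb de norm_triangle_ineq[of b d] norm_triangle_ineq[of "- b" e]
        norm_triangle_ineq4[of b d] norm_triangle_ineq4[of "- b" e] by auto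
    then show "elsasser (b + d) (- b + e) P \<in> H" "elsasser (b - d) (- b - e) P \<in> H"
      using H assms unfolding unit_good_def by blast+
  qed
  ultimately have "(0, b, (1/2) *\<^sub>R (d \<otimes> e + e \<otimes> d) - b \<otimes> b + P *\<^sub>R mat 1, (1/2) *\<^sub>R cross3 d e) \<in> H"
    using H mid_closedD[of H D] unfolding unit_good_def by metis
  then show ?thesis
    by (simp add: b_def tensor_simps)
qed

text \<open>
  A matrix supported on the plane orthogonal to \<open>e1\<close> is an average of four rank-one matrices
  \<open>4 N\<^sub>i\<^sub>j e\<^sub>i \<otimes> e\<^sub>j\<close>; its symmetric part contributes to \<open>S\<close> and its antisymmetric part to \<open>a\<close>.
\<close>

lemma unit_good_eigenvector:
  assumes H: "unit_good H" and f: "frame e1 e2 e3" and \<beta>: "\<bar>\<beta>\<bar> \<le> 1/8"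
    and x: "\<bar>x11\<bar> \<le> 1/64" "\<bar>x22\<bar> \<le> 1/64" "\<bar>x33\<bar> \<le> 1/64" "\<bar>x23\<bar> \<le> 1/64" "\<bar>\<tau>\<bar> \<le> 1/64"
  shows "(0, \<beta> *\<^sub>R e3, frame_mat e1 e2 e3 x11 x22 x33 0 0 x23, \<tau> *\<^sub>R e1) \<in> H"
proof -
  note fD = frameD[OF f]
  have mc: "mid_closed H" using H by (simp add: unit_good_def)
  have e1: "e1 \<noteq> 0" using fD(1) by auto
  have "\<bar>\<beta>\<bar> * \<bar>\<beta>\<bar> \<le> 1/8 * (1/8)"
    using \<beta> by (intro mult_mono) auto
  then have bb: "\<bar>\<beta> * \<beta>\<bar> \<le> 1/64" by (simp add: abs_mult)
  \<comment> \<open>The pressure is \<open>x11\<close>, since every other term vanishes in the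
    direction \<open>e1\<close>. The vectors \<open>v/2\<close> and \<open>2 n w\<close> have norm
    at most \<open>1/2\<close> because \<open>\<bar>n\<bar> \<le> 1/4\<close>.\<close>
  have rank1: "(0, \<beta> *\<^sub>R e3, (n/2) *\<^sub>R (v \<otimes> w + w \<otimes> v) - (\<beta> * \<beta>) *\<^sub>R (e3 \<otimes> e3) + x11 *\<^sub>R mat 1,
    (n/2) *\<^sub>R cross3 v w) \<in> H"
    if "\<bar>n\<bar> \<le> 1/4" "norm v = 1" "norm w = 1" "v \<bullet> e1 = 0" "w \<bullet> e1 = 0" for n v w
  proof -
    have "(0, \<beta> *\<^sub>R e3, (1/2) *\<^sub>R (((1/2) *\<^sub>R v) \<otimes> ((2 * n) *\<^sub>R w) + ((2 * n) *\<^sub>R w) \<otimes> ((1/2) *\<^sub>R v))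
        - (\<beta> * \<beta>) *\<^sub>R (e3 \<otimes> e3) + x11 *\<^sub>R mat 1,
      (1/2) *\<^sub>R cross3 ((1/2) *\<^sub>R v) ((2 * n) *\<^sub>R w)) \<in> H"
    proof (rule unit_good_rank_one[OF H f])
      show "\<bar>\<beta>\<bar> \<le> 1/2" using \<beta> by simp
      show "\<bar>x11\<bar> \<le> 1" using x(1) by simp
    qed (use that in \<open>simp_all add: abs_mult\<close>)
    then show ?thesis
      by (simp add: tensor_simps cross3_scale flip: scaleR_add_right)
  qed
  \<comment> \<open>Each point gets weight \<open>1/4\<close>, hence the factors 4. The term
    \<open>\<beta> * \<beta>\<close> compensates the contribution of \<open>b \<otimes> b\<close>;
    sum and difference of \<open>n23\<close> and \<open>n32\<close> produce \<open>x23\<close> and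
    \<open>\<tau>\<close>.\<close>
  define n22 n33 n23 n32 where n: "n22 = 4 * (x22 - x11)" "n33 = 4 * (x33 - x11 + \<beta> * \<beta>)"
    "n23 = 4 * (x23 + \<tau>)" "n32 = 4 * (x23 - \<tau>)"
  have nb: "\<bar>n22\<bar> \<le> 1/4" "\<bar>n33\<bar> \<le> 1/4" "\<bar>n23\<bar> \<le> 1/4" "\<bar>n32\<bar> \<le> 1/4"
    using x bb unfolding n abs_le_iff by (simp_all add: field_simps)
  have "(n22/2) *\<^sub>R (e2 \<otimes> e2 + e2 \<otimes> e2) - (\<beta> * \<beta>) *\<^sub>R (e3 \<otimes> e3) + x11 *\<^sub>R mat 1
      = frame_mat e1 e2 e3 x11 (x11 + n22) (x11 - \<beta> * \<beta>) 0 0 0"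
    by (simp add: mat_1_eq_frame_mat[OF f] frame_mat_def vec_eq_iff tensor_def field_simps)
  then have P22: "(0, \<beta> *\<^sub>R e3, frame_mat e1 e2 e3 x11 (x11 + n22) (x11 - \<beta> * \<beta>) 0 0 0, 0) \<in> H"
    using rank1[OF nb(1), of e2 e2] by (simp add: fD)
  have "(n33/2) *\<^sub>R (e3 \<otimes> e3 + e3 \<otimes> e3) - (\<beta> * \<beta>) *\<^sub>R (e3 \<otimes> e3) + x11 *\<^sub>R mat 1
      = frame_mat e1 e2 e3 x11 x11 (x11 - \<beta> * \<beta> + n33) 0 0 0"
    by (simp add: mat_1_eq_frame_mat[OF f] frame_mat_def vec_eq_iff tensor_def field_simps)
  then have P33: "(0, \<beta> *\<^sub>R e3, frame_mat e1 e2 e3 x11 x11 (x11 - \<beta> * \<beta> + n33) 0 0 0, 0) \<in> H"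
    using rank1[OF nb(2), of e3 e3] by (simp add: fD)
  have "(n23/2) *\<^sub>R (e2 \<otimes> e3 + e3 \<otimes> e2) - (\<beta> * \<beta>) *\<^sub>R (e3 \<otimes> e3) + x11 *\<^sub>R mat 1
      = frame_mat e1 e2 e3 x11 x11 (x11 - \<beta> * \<beta>) 0 0 (n23/2)"
    by (simp add: mat_1_eq_frame_mat[OF f] frame_mat_def vec_eq_iff tensor_def field_simps)
  then have P23: "(0, \<beta> *\<^sub>R e3, frame_mat e1 e2 e3 x11 x11 (x11 - \<beta> * \<beta>) 0 0 (n23/2), (n23/2) *\<^sub>R e1) \<in> H"
    using rank1[OF nb(3), of e2 e3] by (simp add: fD)
  have "(n32/2) *\<^sub>R (e3 \<otimes> e2 + e2 \<otimes> e3) - (\<beta> * \<beta>) *\<^sub>R (e3 \<otimes> e3) + x11 *\<^sub>R mat 1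
      = frame_mat e1 e2 e3 x11 x11 (x11 - \<beta> * \<beta>) 0 0 (n32/2)"
    by (simp add: mat_1_eq_frame_mat[OF f] frame_mat_def vec_eq_iff tensor_def field_simps)
  then have P32: "(0, \<beta> *\<^sub>R e3, frame_mat e1 e2 e3 x11 x11 (x11 - \<beta> * \<beta>) 0 0 (n32/2), - (n32/2) *\<^sub>R e1) \<in> H"
    using rank1[OF nb(4), of e3 e2] by (simp add: fD)
  \<comment> \<open>All four points share the \<open>e1\<close> row of the matrix and have
    \<open>a\<close> along \<open>e1\<close>, so \<open>\<xi> = e1\<close> serves in all three
    averages.\<close>
  have V1: "(0, \<beta> *\<^sub>R e3, frame_mat e1 e2 e3 x11 (x11 + n22/2) (x11 - \<beta> * \<beta> + n33/2) 0 0 0, 0) \<in> H"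
    by (rule mid_closed_fixed[OF mc P22 P33, where D = "frame_mat e1 e2 e3 0 (n22/2) (- n33/2) 0 0 0"
          and \<delta> = 0 and \<xi> = e1])
      (use e1 in \<open>auto simp: frame_mat_add frame_mat_diff frame_mat_mult_frame[OF f] add_ac\<close>)
  have nn: "n23/2 = 2 * x23 + 2 * \<tau>" "n32/2 = 2 * x23 - 2 * \<tau>"
    by (simp_all add: n field_simps)
  have V2: "(0, \<beta> *\<^sub>R e3, frame_mat e1 e2 e3 x11 x11 (x11 - \<beta> * \<beta>) 0 0 (2 * x23), (2 * \<tau>) *\<^sub>R e1) \<in> H"
    by (rule mid_closed_fixed[OF mc P23[unfolded nn] P32[unfolded nn], where D = "frame_mat e1 e2 e3 0 0 0 0 0 (2 * \<tau>)"
          and \<delta> = "(2 * x23) *\<^sub>R e1" and \<xi> = e1])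
      (use e1 in \<open>auto simp: frame_mat_add frame_mat_diff frame_mat_mult_frame[OF f] cross3_scale scaleR_add_left scaleR_diff_left\<close>)
  have nn': "x11 + n22/2 = 2 * x22 - x11" "x11 - \<beta> * \<beta> + n33/2 = 2 * x33 + (\<beta> * \<beta> - x11)"
    by (simp_all add: n field_simps)
  show ?thesis
    by (rule mid_closed_fixed[OF mc V1[unfolded nn'] V2,
          where D = "frame_mat e1 e2 e3 0 (x22 - x11) (x33 - (x11 - \<beta> * \<beta>)) 0 0 (- x23)"
          and \<delta> = "- \<tau> *\<^sub>R e1" and \<xi> = e1])
      (use e1 in \<open>auto simp: frame_mat_add frame_mat_diff frame_mat_mult_frame[OF f] cross3_scale simp flip: scaleR_add_left\<close>)
qed

text \<open>
  With \<open>u = 0\<close> and \<open>b\<close> fixed, \<open>b \<bullet> S a\<close> is affine along wave-cone segments (\<open>S \<xi> = 0\<close>, \<open>a\<close> parallel to \<open>\<xi>\<close>)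
  and vanishes on the rank-one points, so the last hypothesis cannot be dropped as long as \<open>b\<close> is
  not varied.
\<close>

lemma unit_good_diagonal_12:
  assumes H: "unit_good H" and f: "frame e1 e2 e3" and \<beta>: "\<bar>\<beta>\<bar> \<le> 1/8"
    and x: "\<bar>x11\<bar> \<le> 1/128" "\<bar>x22\<bar> \<le> 1/128" "\<bar>x33\<bar> \<le> 1/128" "\<bar>x13\<bar> \<le> 1/128" "\<bar>x23\<bar> \<le> 1/128"
      "\<bar>a1\<bar> \<le> 1/128" "\<bar>a2\<bar> \<le> 1/128"
    and ax: "a1 * x13 + a2 * x23 = 0"
  shows "(0, \<beta> *\<^sub>R e3, frame_mat e1 e2 e3 x11 x22 x33 0 x13 x23, a1 *\<^sub>R e1 + a2 *\<^sub>R e2) \<in> H"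
proof -
  note fD = frameD[OF f]
  have mc: "mid_closed H" using H by (simp add: unit_good_def)
  have le: "\<bar>y\<bar> \<le> 1/64" "\<bar>2 * y\<bar> \<le> 1/64" "\<bar>- 2 * y\<bar> \<le> 1/64" if "\<bar>y\<bar> \<le> 1/128" for y :: real
    using that by auto
  have V: "(0, \<beta> *\<^sub>R e3, frame_mat e1 e2 e3 x11 x22 x33 0 0 (2 * x23), (2 * a1) *\<^sub>R e1) \<in> H"
    by (rule unit_good_eigenvector[OF H f \<beta>]; (rule le, rule x))
  \<comment> \<open>In the quarter-turned frame \<open>a\<close> may point along \<open>e2\<close>;
    this point carries the doubled \<open>x13\<close>, as \<open>V\<close> carries the doubled
    \<open>x23\<close>.\<close>
  have "(0, \<beta> *\<^sub>R e3, frame_mat e2 (- e1) e3 x22 x11 x33 0 0 (- 2 * x13), (2 * a2) *\<^sub>R e2) \<in> H"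
    by (rule unit_good_eigenvector[OF H frame_quarter_turn[OF f] \<beta>]; (rule le, rule x | simp))
  then have W: "(0, \<beta> *\<^sub>R e3, frame_mat e1 e2 e3 x11 x22 x33 0 (2 * x13) 0, (2 * a2) *\<^sub>R e2) \<in> H"
    by (simp add: frame_mat_minus_frame)
  \<comment> \<open>On \<open>k1 *\<^sub>R e1 + k2 *\<^sub>R e2\<close> the half-difference of the
    matrices gives \<open>(x23 * k2 - x13 * k1) *\<^sub>R e3\<close>. If \<open>a\<close> is
    nonzero, \<open>\<xi>\<close> is taken to be \<open>a1 *\<^sub>R e1 - a2 *\<^sub>R e2\<close>,
    and the kernel condition is then exactly \<open>ax\<close>.\<close>
  obtain k1 k2 where k: "k1 \<noteq> 0 \<or> k2 \<noteq> (0::real)" "x23 * k2 = x13 * k1"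
    "cross3 (k1 *\<^sub>R e1 + k2 *\<^sub>R e2) (a1 *\<^sub>R e1 - a2 *\<^sub>R e2) = 0"
  proof (cases "a1 = 0 \<and> a2 = 0")
    case True
    show ?thesis
    proof (cases "x13 = 0 \<and> x23 = 0")
      case True
      with \<open>a1 = 0 \<and> a2 = 0\<close> show ?thesis by (intro that[of 1 0]) auto
    next
      case False
      with \<open>a1 = 0 \<and> a2 = 0\<close> show ?thesis by (intro that[of x23 x13]) auto
    qed
  next
    case False
    then show ?thesis
      using ax by (intro that[of a1 "- a2"]) (auto simp: algebra_simps)
  qed
  define \<xi> where "\<xi> = k1 *\<^sub>R e1 + k2 *\<^sub>R e2"
  have "\<xi> \<bullet> e1 = k1" "\<xi> \<bullet> e2 = k2" by (auto simp: \<xi>_def inner_simps fD)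
  then have \<xi>: "\<xi> \<noteq> 0" using k by auto
  have D\<xi>: "frame_mat e1 e2 e3 0 0 0 0 (- x13) x23 *v \<xi> = 0"
    using frame_mat_mult_vec[OF f, of 0 0 0 0 "- x13" x23 k1 k2 0] k by (simp add: \<xi>_def)
  have "(2 * a1) *\<^sub>R e1 = a1 *\<^sub>R e1 + a2 *\<^sub>R e2 + (a1 *\<^sub>R e1 - a2 *\<^sub>R e2)"
    "(2 * a2) *\<^sub>R e2 = a1 *\<^sub>R e1 + a2 *\<^sub>R e2 - (a1 *\<^sub>R e1 - a2 *\<^sub>R e2)"
    by (simp_all add: vec_eq_iff)
  then show ?thesis
    by (intro mid_closed_fixed[OF mc V W, where D = "frame_mat e1 e2 e3 0 0 0 0 (- x13) x23"
          and \<delta> = "a1 *\<^sub>R e1 - a2 *\<^sub>R e2" and \<xi> = \<xi>])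
      (use \<xi> D\<xi> k(3) in \<open>auto simp: frame_mat_add frame_mat_diff \<xi>_def\<close>)
qed

lemma half_scale_tensor:
  assumes "c * c = 1/2"
  shows "(c *\<^sub>R v) \<otimes> (c *\<^sub>R w) = (1/2) *\<^sub>R (v \<otimes> w)"
  using assms by (simp add: tensor_simps)

lemma exists_sqrt_half: "\<exists>c::real. c * c = 1/2 \<and> 0 \<le> c \<and> c \<le> 1"
  by (rule exI[of _ "sqrt (1/2)"]) (auto simp: real_sqrt_le_iff)

lemma scale_tensor_half:
  assumes "c * c = 1/2"
  shows "(c * z) *\<^sub>R ((c *\<^sub>R v) \<otimes> w + w \<otimes> (c *\<^sub>R v)) = (z/2) *\<^sub>R (v \<otimes> w + w \<otimes> v)"
    "(c * z) *\<^sub>R (w \<otimes> (c *\<^sub>R v) + (c *\<^sub>R v) \<otimes> w) = (z/2) *\<^sub>R (v \<otimes> w + w \<otimes> v)"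
proof -
  have "c * z * c = z / 2" using assms by (simp add: mult.assoc mult.left_commute)
  then show "(c * z) *\<^sub>R ((c *\<^sub>R v) \<otimes> w + w \<otimes> (c *\<^sub>R v)) = (z/2) *\<^sub>R (v \<otimes> w + w \<otimes> v)"
    by (simp add: tensor_simps flip: scaleR_add_right)
  then show "(c * z) *\<^sub>R (w \<otimes> (c *\<^sub>R v) + (c *\<^sub>R v) \<otimes> w) = (z/2) *\<^sub>R (v \<otimes> w + w \<otimes> v)"
    by (simp add: add.commute)
qed

text \<open>With equal 11 and 22 entries, \<open>e1 + e2\<close> and \<open>e2 - e1\<close>
  diagonalise the 12 block. Writing \<open>e2\<close> as a multiple of the sum of the turned vectors
  splits \<open>z\<close> into two equal entries.\<close>

lemma frame_mat_eighth_turn: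
  assumes "c * c = 1/2"
  shows "frame_mat (c *\<^sub>R (e1 + e2)) (c *\<^sub>R (e2 - e1)) e3 (m + 2 * y) (m - 2 * y) x33 0 (c * z) (c * z)
    = frame_mat e1 e2 e3 m m x33 (2 * y) 0 z"
  unfolding frame_mat_def scale_tensor_half[OF assms] half_scale_tensor[OF assms]
  by (simp add: vec_eq_iff tensor_def field_simps)

text \<open>The \<open>x12\<close> entry comes from averaging a point without it and a point with
  twice that entry, the latter being diagonal in the 12 block of a frame turned by 45 degrees about
  \<open>e3\<close>.\<close>

lemma unit_good_zero_13:
  assumes H: "unit_good H" and f: "frame e1 e2 e3" and \<beta>: "\<bar>\<beta>\<bar> \<le> 1/8"
    and x: "\<bar>x11\<bar> \<le> 1/512" "\<bar>x22\<bar> \<le> 1/512" "\<bar>x33\<bar> \<le> 1/512" "\<bar>x12\<bar> \<le> 1/512" "\<bar>x23\<bar> \<le> 1/512"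
      "\<bar>\<alpha>\<bar> \<le> 1/512"
  shows "(0, \<beta> *\<^sub>R e3, frame_mat e1 e2 e3 x11 x22 x33 x12 0 x23, \<alpha> *\<^sub>R e1) \<in> H"
proof -
  note fD = frameD[OF f]
  have mc: "mid_closed H" using H by (simp add: unit_good_def)
  have e3: "e3 \<noteq> 0" using fD(3) by auto
  \<comment> \<open>Chosen so that the diagonals \<open>x11 + h\<close>, \<open>x22 - h\<close> and
    \<open>m\<close>, \<open>m\<close> average to \<open>x11\<close>, \<open>x22\<close>.\<close>
  define m h where mh: "m = (x11 + x22) / 2" "h = (x11 - x22) / 2"
  obtain c :: real where c: "c * c = 1/2" "0 \<le> c" "c \<le> 1"
    using exists_sqrt_half by blast
  have cb: "\<bar>c * y\<bar> \<le> \<bar>y\<bar>" for y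
    using c mult_right_mono[of c 1 "\<bar>y\<bar>"] by (simp add: abs_mult)
  have "\<bar>x11 + h\<bar> \<le> 1/64" "\<bar>x22 - h\<bar> \<le> 1/64"
    using x(1,2) unfolding mh abs_le_iff by (simp_all add: field_simps)
  then have V: "(0, \<beta> *\<^sub>R e3, frame_mat e1 e2 e3 (x11 + h) (x22 - h) x33 0 0 x23, \<alpha> *\<^sub>R e1) \<in> H"
    using x(3,5,6) by (intro unit_good_eigenvector[OF H f \<beta>]) auto
  have b: "\<bar>m + 2 * x12\<bar> \<le> 1/128" "\<bar>m - 2 * x12\<bar> \<le> 1/128"
    using x(1,2,4) unfolding mh abs_le_iff by (simp_all add: field_simps)
  \<comment> \<open>In the turned frame \<open>\<alpha> *\<^sub>R e1\<close> has opposite components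
    while the 13 and 23 entries are equal, so the hypothesis of \<open>unit_good_diagonal_12\<close>
    holds by cancellation.\<close>
  have "(0, \<beta> *\<^sub>R e3, frame_mat (c *\<^sub>R (e1 + e2)) (c *\<^sub>R (e2 - e1)) e3
        (m + 2 * x12) (m - 2 * x12) x33 0 (c * x23) (c * x23),
      (c * \<alpha>) *\<^sub>R (c *\<^sub>R (e1 + e2)) + (- (c * \<alpha>)) *\<^sub>R (c *\<^sub>R (e2 - e1))) \<in> H"
    using x(3) b order_trans[OF cb x(5)] order_trans[OF cb x(6)]
    by (intro unit_good_diagonal_12[OF H frame_eighth_turn[OF f c(1)] \<beta>]) auto
  moreover have "(c * \<alpha>) *\<^sub>R (c *\<^sub>R (e1 + e2)) + (- (c * \<alpha>)) *\<^sub>R (c *\<^sub>R (e2 - e1)) = \<alpha> *\<^sub>R e1"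
  proof -
    have "(c * \<alpha>) *\<^sub>R (c *\<^sub>R (e1 + e2)) + (- (c * \<alpha>)) *\<^sub>R (c *\<^sub>R (e2 - e1)) = (2 * (c * c) * \<alpha>) *\<^sub>R e1"
      by (simp add: vec_eq_iff algebra_simps)
    then show ?thesis by (simp add: c)
  qed
  ultimately have W: "(0, \<beta> *\<^sub>R e3, frame_mat e1 e2 e3 m m x33 (2 * x12) 0 x23, \<alpha> *\<^sub>R e1) \<in> H"
    by (simp only: frame_mat_eighth_turn[OF c(1)])
  show ?thesis
    by (rule mid_closed_fixed[OF mc V W, where D = "frame_mat e1 e2 e3 h (- h) 0 (- x12) 0 0"
          and \<delta> = 0 and \<xi> = e3])
      (use e3 in \<open>auto simp: frame_mat_add frame_mat_diff frame_mat_mult_frame[OF f] mh field_simps\<close>)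
qed

lemma frame_eighth_turn_13:
  assumes "frame e1 e2 e3" "c * c = 1/2" "s = 1 \<or> s = -1"
  shows "frame (c *\<^sub>R (e1 - s *\<^sub>R e3)) e2 (c *\<^sub>R (e3 + s *\<^sub>R e1))"
proof -
  have cc: "c * 2 * c = 1" "c * c * 2 = 1"
    using assms(2) by auto
  show ?thesis
    using assms(3)
    by (elim disjE) (simp_all add: cc frame_def frameD[OF assms(1)] inner_simps cross3_bilinear_simps
        scaleR_2 [symmetric] flip: mult.assoc)
qed

text \<open>Equal 11 and 33 entries make \<open>e1 + e3\<close> and \<open>e1 - e3\<close>
  diagonalise the 13 block, so \<open>y\<close> moves to the diagonal and the 13 entry disappears,
  for either sense of rotation about \<open>e2\<close>.\<close>

lemma frame_mat_eighth_turn_13: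
  assumes "c * c = 1/2" "s = 1 \<or> s = -1"
  shows "frame_mat (c *\<^sub>R (e1 - s *\<^sub>R e3)) e2 (c *\<^sub>R (e3 + s *\<^sub>R e1)) (m - s * y) x22 (m + s * y)
      (c * (x12 - s * x23)) 0 (c * (x23 + s * x12))
    = frame_mat e1 e2 e3 m x22 m x12 y x23"
  using assms(2) unfolding frame_mat_def scale_tensor_half[OF assms(1)] half_scale_tensor[OF assms(1)]
  by (elim disjE) (simp_all add: vec_eq_iff tensor_def field_simps)

text \<open>
  The obstruction \<open>b \<bullet> S a = 0\<close> is removed by moving \<open>b\<close>: once \<open>S\<^sub>1\<^sub>1 = S\<^sub>3\<^sub>3\<close>, the segment with endpoints
  \<open>b = \<beta> (e3 \<plusminus> e1)\<close>, \<open>a = \<alpha> (e1 \<mp> e3)\<close> is in a wave-cone direction (\<open>\<xi> = e3\<close>, \<open>c = 0\<close>) and the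
  obstruction vanishes at both endpoints.
\<close>

lemma unit_good_frame:
  assumes H: "unit_good H" and f: "frame e1 e2 e3" and \<beta>: "\<bar>\<beta>\<bar> \<le> 1/2048"
    and x: "\<bar>x11\<bar> \<le> 1/2048" "\<bar>x22\<bar> \<le> 1/2048" "\<bar>x33\<bar> \<le> 1/2048" "\<bar>x12\<bar> \<le> 1/2048" "\<bar>x13\<bar> \<le> 1/2048"
      "\<bar>x23\<bar> \<le> 1/2048" "\<bar>\<alpha>\<bar> \<le> 1/2048"
  shows "(0, \<beta> *\<^sub>R e3, frame_mat e1 e2 e3 x11 x22 x33 x12 x13 x23, \<alpha> *\<^sub>R e1) \<in> H"
proof -
  note fD = frameD[OF f]
  have mc: "mid_closed H" using H by (simp add: unit_good_def)
  have e: "e3 \<noteq> 0" "e2 \<noteq> 0" using fD(2,3) by auto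
  define m h where mh: "m = (x11 + x33) / 2" "h = (x11 - x33) / 2"
  obtain c :: real where c: "c * c = 1/2" "0 \<le> c" "c \<le> 1"
    using exists_sqrt_half by blast
  have cb: "\<bar>c * y\<bar> \<le> \<bar>y\<bar>" for y
    using c mult_right_mono[of c 1 "\<bar>y\<bar>"] by (simp add: abs_mult)
  have "\<bar>x11 + h\<bar> \<le> 1/512" "\<bar>x33 - h\<bar> \<le> 1/512"
    using x(1,3) unfolding mh abs_le_iff by (simp_all add: field_simps)
  then have V: "(0, \<beta> *\<^sub>R e3, frame_mat e1 e2 e3 (x11 + h) x22 (x33 - h) x12 0 x23, \<alpha> *\<^sub>R e1) \<in> H"
    using x(2,4,6,7) \<beta> by (intro unit_good_zero_13[OF H f]) auto
  have turned: "(0, \<beta> *\<^sub>R (e3 + s *\<^sub>R e1), frame_mat e1 e2 e3 m x22 m x12 (2 * x13) x23, \<alpha> *\<^sub>R (e1 - s *\<^sub>R e3)) \<in> H"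
    if s: "s = 1 \<or> s = -1" for s
  proof -
    have sb: "\<bar>s * y\<bar> = \<bar>y\<bar>" for y
      using s by auto
    have m: "\<bar>m\<bar> \<le> 1/2048"
      using x(1,3) unfolding mh abs_le_iff by (simp_all add: field_simps)
    have b: "\<bar>m - s * (2 * x13)\<bar> \<le> 1/512" "\<bar>m + s * (2 * x13)\<bar> \<le> 1/512"
      using m x(5) sb[of "2 * x13"] by linarith+
    have b': "\<bar>x12 - s * x23\<bar> \<le> 1/512" "\<bar>x23 + s * x12\<bar> \<le> 1/512"
      using x(4,6) sb[of x12] sb[of x23] by linarith+
    have "(0, (2 * (c * \<beta>)) *\<^sub>R (c *\<^sub>R (e3 + s *\<^sub>R e1)),
        frame_mat (c *\<^sub>R (e1 - s *\<^sub>R e3)) e2 (c *\<^sub>R (e3 + s *\<^sub>R e1)) (m - s * (2 * x13)) x22 (m + s * (2 * x13))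
          (c * (x12 - s * x23)) 0 (c * (x23 + s * x12)),
        (2 * (c * \<alpha>)) *\<^sub>R (c *\<^sub>R (e1 - s *\<^sub>R e3))) \<in> H"
    proof (rule unit_good_zero_13[OF H frame_eighth_turn_13[OF f c(1) s] _ b(1) _ b(2)
          order_trans[OF cb b'(1)] order_trans[OF cb b'(2)]])
      show "\<bar>2 * (c * \<beta>)\<bar> \<le> 1/8" using cb[of \<beta>] \<beta> by linarith
      show "\<bar>x22\<bar> \<le> 1/512" using x(2) by linarith
      show "\<bar>2 * (c * \<alpha>)\<bar> \<le> 1/512" using cb[of \<alpha>] x(7) by linarith
    qed
    moreover have "(2 * (c * k)) *\<^sub>R (c *\<^sub>R v) = k *\<^sub>R v" for k and v :: "real^3"
    proof -
      have "2 * (c * k) * c = k" using c by (simp add: mult.assoc mult.left_commute)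
      then show ?thesis by simp
    qed
    ultimately show ?thesis
      by (simp only: frame_mat_eighth_turn_13[OF c(1) s])
  qed
  have W: "(0, \<beta> *\<^sub>R e3, frame_mat e1 e2 e3 m x22 m x12 (2 * x13) x23, \<alpha> *\<^sub>R e1) \<in> H"
  proof (rule mid_closedD[OF mc])
    show "(0, \<beta> *\<^sub>R e1, 0, - \<alpha> *\<^sub>R e3) \<in> wave_cone"
      by (rule wave_coneI[where \<xi> = e3 and c = 0])
        (use e fD in \<open>auto simp: symmetric_simps cross3_scale transpose_def vec_eq_iff\<close>)
  qed (use turned[of 1] turned[of "-1"] in \<open>simp_all add: algebra_simps\<close>)
  \<comment> \<open>\<open>V\<close> has no 13 entry and \<open>W\<close> has twice
    \<open>x13\<close>; the half-difference lives in the plane of \<open>e1\<close> and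
    \<open>e3\<close>, with \<open>e2\<close> in its kernel.\<close>
  show ?thesis
    by (rule mid_closed_fixed[OF mc V W, where D = "frame_mat e1 e2 e3 h 0 (- h) 0 (- x13) 0"
          and \<delta> = 0 and \<xi> = e2])
      (use e in \<open>auto simp: frame_mat_add frame_mat_diff frame_mat_mult_frame[OF f] mh field_simps\<close>)
qed

subsection \<open>A neighbourhood of zero in the hull\<close>

text \<open>Nonzero vectors are normalised; a zero vector gets coefficient 0 and any axis orthogonal
  to the other vector.\<close>

lemma exists_frame_adapted:
  fixes a b :: "real^3"
  assumes "a \<bullet> b = 0"
  shows "\<exists>e1 e2 e3 \<alpha> \<beta>. frame e1 e2 e3 \<and> a = \<alpha> *\<^sub>R e1 \<and> b = \<beta> *\<^sub>R e3"
proof -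
  obtain e3 \<beta> where e3: "norm e3 = 1" "b = \<beta> *\<^sub>R e3" "a \<bullet> e3 = 0"
  proof (cases "b = 0")
    case True
    then show ?thesis
      using exists_orthogonal_of_norm[of 1 a] that[of _ 0] by auto
  next
    case False
    then show ?thesis
      using assms by (intro that[of "(1 / norm b) *\<^sub>R b" "norm b"]) auto
  qed
  obtain e1 \<alpha> where e1: "norm e1 = 1" "a = \<alpha> *\<^sub>R e1" "e1 \<bullet> e3 = 0"
  proof (cases "a = 0")
    case True
    then show ?thesis
      using exists_orthogonal_of_norm[of 1 e3] that[of _ 0] by (auto simp: inner_commute)
  next
    case False
    then show ?thesis
      using e3 by (intro that[of "(1 / norm a) *\<^sub>R a" "norm a"]) auto
  qed
  show ?thesis
    using frame_cross3[OF e1(1) e3(1) e1(3)] e1(2) e3(2) by blast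
qed

lemma unit_good_near_zero:
  assumes H: "unit_good H" and S: "symmetric_matrix S" and "a \<bullet> b = 0"
    and small: "norm b \<le> 1/2048" "norm S \<le> 1/2048" "norm a \<le> 1/2048"
  shows "(0, b, S, a) \<in> H"
proof -
  obtain e1 e2 e3 \<alpha> \<beta> where f: "frame e1 e2 e3" and ab: "a = \<alpha> *\<^sub>R e1" "b = \<beta> *\<^sub>R e3"
    using exists_frame_adapted[OF assms(3)] by blast
  note fD = frameD[OF f]
  \<comment> \<open>A matrix entry is the inner product of \<open>S\<close> with a unit tensor, so
    Cauchy-Schwarz bounds it by \<open>norm S\<close>.\<close>
  have c: "\<bar>v \<bullet> (S *v w)\<bar> \<le> 1/2048" if "norm v = 1" "norm w = 1" for v w
    using Cauchy_Schwarz_ineq2[of S "v \<otimes> w"] that small(2) by (simp add: inner_tensor norm_tensor)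
  have "\<bar>\<alpha>\<bar> \<le> 1/2048" "\<bar>\<beta>\<bar> \<le> 1/2048"
    using small(1,3) ab fD(16-18) by auto
  then show ?thesis
    unfolding ab by (subst symmetric_eq_frame_mat[OF f S], intro unit_good_frame[OF H f] c fD(16-18))
qed

text \<open>The boost sends the unit ball of each Elsasser variable into the ball of radius
  \<open>2 * \<rho>\<close>, inside those of radius \<open>r\<close> and \<open>s\<close>; pressures
  are scaled by \<open>\<rho>\<^sup>2 \<le> r * s\<close>.\<close>

lemma unit_good_galilei:
  assumes "norm v \<le> \<rho>" "0 \<le> \<rho>" "2 * \<rho> \<le> r" "2 * \<rho> \<le> s"
  shows "unit_good (galilei v \<rho> -` lamination_hull wave_cone (K_set r s))"
  unfolding unit_good_def
proof (intro conjI allI impI)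
  show "mid_closed (galilei v \<rho> -` lamination_hull wave_cone (K_set r s))"
    by (rule mid_closed_galilei[OF mid_closed_lamination_hull])
  fix p q :: "real^3" and P :: real
  assume pq: "norm p \<le> 1" "norm q \<le> 1" "\<bar>P\<bar> \<le> 1"
  have bound: "norm (v + \<rho> *\<^sub>R x) \<le> 2 * \<rho>" if "norm x \<le> 1" for x
    using norm_triangle_ineq[of v "\<rho> *\<^sub>R x"] mult_left_mono[OF that assms(2)] assms by simp
  have "\<rho>\<^sup>2 * \<bar>P\<bar> \<le> \<rho>\<^sup>2 * 1"
    using pq by (intro mult_left_mono) auto
  also have "\<rho>\<^sup>2 * 1 \<le> r * s"
    using mult_mono[of \<rho> r \<rho> s] assms by (simp add: power2_eq_square)
  finally have "\<bar>\<rho>\<^sup>2 * P\<bar> \<le> r * s"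
    by (simp add: abs_mult)
  then show "elsasser p q P \<in> galilei v \<rho> -` lamination_hull wave_cone (K_set r s)"
    using bound[OF pq(1)] bound[OF pq(2)] assms by (auto simp: galilei_els intro!: elsasser_in_hull)
qed

lemma hull_near_zero:
  assumes "r > 0" "s > 0"
  obtains \<delta> where "\<delta> > 0"
    "\<And>u b S a. (u, b, S, a) \<in> constraint_set \<Longrightarrow> norm (u, b, S, a) < \<delta> \<Longrightarrow>
      (u, b, S, a) \<in> lamination_hull wave_cone (K_set r s)"
proof -
  define \<rho> where "\<rho> = min r s / 2"
  define \<epsilon> :: real where "\<epsilon> = 1/2048"
  \<comment> \<open>The bound 1 makes products of two small vectors at most \<open>\<delta>\<close>,
    and \<open>\<rho>\<close> admits \<open>u\<close> as boost velocity. The last two keep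
    \<open>b'\<close>, \<open>S'\<close> and \<open>a'\<close> below \<open>\<epsilon>\<close>,
    where \<open>S - u \<otimes> u\<close> and \<open>a - cross3 b u\<close> have norm at most
    \<open>2 * \<delta>\<close>.\<close>
  define \<delta> where "\<delta> = min (min 1 \<rho>) (min (\<epsilon> * \<rho>) (\<epsilon> * \<rho>\<^sup>2 / 2))"
  have \<rho>: "\<rho> > 0" "2 * \<rho> \<le> r" "2 * \<rho> \<le> s" using assms by (auto simp: \<rho>_def)
  have \<delta>: "\<delta> > 0" "\<delta> \<le> 1" "\<delta> \<le> \<rho>" "\<delta> \<le> \<epsilon> * \<rho>" "2 * \<delta> \<le> \<epsilon> * \<rho>\<^sup>2"
    using \<rho>(1) by (auto simp: \<delta>_def \<epsilon>_def)
  have "(u, b, S, a) \<in> lamination_hull wave_cone (K_set r s)"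
    if C: "(u, b, S, a) \<in> constraint_set" and n: "norm (u, b, S, a) < \<delta>" for u b S a
  proof -
    have small: "norm u \<le> \<delta>" "norm b \<le> \<delta>" "norm S \<le> \<delta>" "norm a \<le> \<delta>"
      using n norm_fst_le[of u "(b, S, a)"] norm_snd_le[of "(b, S, a)" u]
        norm_fst_le[of b "(S, a)"] norm_snd_le[of "(S, a)" b] norm_fst_le[of S a] norm_snd_le[of a S]
      by linarith+
    \<comment> \<open>The preimage of the state under \<open>galilei u \<rho>\<close> with zero
      velocity. Orthogonality of \<open>a'\<close> and \<open>b'\<close> persists since
      \<open>cross3 b u\<close> is orthogonal to \<open>b\<close>.\<close>
    define b' S' a' where "b' = (1/\<rho>) *\<^sub>R b" and "S' = (1/\<rho>\<^sup>2) *\<^sub>R (S - u \<otimes> u)"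
      and "a' = (1/\<rho>\<^sup>2) *\<^sub>R (a - cross3 b u)"
    have sq: "norm v * norm w \<le> \<delta>" if "norm v \<le> \<delta>" "norm w \<le> \<delta>" for v w :: "real^3"
      using mult_mono[of "norm v" \<delta> "norm w" 1] that \<delta> by auto
    have scale: "norm ((1/\<rho>\<^sup>2) *\<^sub>R v) \<le> \<epsilon>" if "norm v \<le> \<epsilon> * \<rho>\<^sup>2" for v :: "'b::real_normed_vector"
      using that \<rho>(1) by (simp add: divide_le_eq)
    have "norm (S - u \<otimes> u) \<le> 2 * \<delta>"
      using norm_triangle_ineq4[of S "u \<otimes> u"] small sq[of u u] by (simp add: norm_tensor)
    then have "norm (S - u \<otimes> u) \<le> \<epsilon> * \<rho>\<^sup>2" using \<delta> by linarith
    then have S': "norm S' \<le> \<epsilon>"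
      unfolding S'_def by (rule scale)
    have "norm (a - cross3 b u) \<le> 2 * \<delta>"
      using norm_triangle_ineq4[of a "cross3 b u"] small sq[of b u] norm_cross_dot[of b u]
      by (smt (verit, best) norm_ge_zero power2_le_imp_le mult_nonneg_nonneg zero_le_power2)
    then have "norm (a - cross3 b u) \<le> \<epsilon> * \<rho>\<^sup>2" using \<delta> by linarith
    then have a': "norm a' \<le> \<epsilon>"
      unfolding a'_def by (rule scale)
    have b': "norm b' \<le> \<epsilon>"
      using small(2) \<delta>(4) \<rho>(1) by (simp add: b'_def divide_le_eq)
    have "symmetric_matrix S'" "a' \<bullet> b' = 0"
      using C by (auto simp: constraint_set_def S'_def a'_def b'_def symmetric_simps inner_simps dot_cross_self)
    moreover have "unit_good (galilei u \<rho> -` lamination_hull wave_cone (K_set r s))"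
      using small(1) \<delta> \<rho> by (intro unit_good_galilei) auto
    ultimately have "(0, b', S', a') \<in> galilei u \<rho> -` lamination_hull wave_cone (K_set r s)"
      using S' a' b' by (intro unit_good_near_zero) (auto simp: \<epsilon>_def)
    moreover have "galilei u \<rho> (0, b', S', a') = (u, b, S, a)"
      using \<rho>(1) by (simp add: galilei_def b'_def S'_def a'_def cross3_scale)
    ultimately show ?thesis by simp
  qed
  with \<delta>(1) show ?thesis by (rule that)
qed

lemma U_set_near_zero:
  assumes "r > 0" "s > 0"
  obtains \<delta> where "\<delta> > 0"
    "\<And>u b S a. symmetric_matrix S \<Longrightarrow> a \<bullet> b = 0 \<Longrightarrow> norm (u, b, S, a) < \<delta> \<Longrightarrow>
      (u, b, S, a) \<in> U_set r s"
proof -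
  obtain \<delta> where \<delta>: "\<delta> > 0" and hull: "\<And>u b S a. (u, b, S, a) \<in> constraint_set \<Longrightarrow>
      norm (u, b, S, a) < \<delta> \<Longrightarrow> (u, b, S, a) \<in> lamination_hull wave_cone (K_set r s)"
    using hull_near_zero[OF assms] by blast
  have "openin (top_of_set constraint_set) (constraint_set \<inter> ball 0 \<delta>)"
    by (auto simp: openin_open)
  moreover have "constraint_set \<inter> ball 0 \<delta> \<subseteq> lamination_hull wave_cone (K_set r s)"
    using hull by auto
  ultimately have sub: "constraint_set \<inter> ball 0 \<delta> \<subseteq> U_set r s"
    unfolding U_set_def by (rule interior_of_maximal[rotated])
  show ?thesis
  proof (rule that[OF \<delta>])
    fix u b a :: "real^3" and S assume "symmetric_matrix S" "a \<bullet> b = 0" "norm (u, b, S, a) < \<delta>"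
    then have "(u, b, S, a) \<in> constraint_set \<inter> ball 0 \<delta>"
      by (auto simp: constraint_set_def)
    then show "(u, b, S, a) \<in> U_set r s" using sub by blast
  qed
qed

subsection \<open>Smooth compactly supported fields\<close>

lemma C_k_SucI:
  assumes "\<And>p. (f has_derivative D p) (at p)" "\<And>v. C_k k (\<lambda>p. D p v)"
  shows "C_k (Suc k) f"
  using assms frechet_derivative_at[OF assms(1)] by (auto simp: differentiable_def)

lemma C_k_Suc_has_derivative:
  "C_k (Suc k) f \<Longrightarrow> (f has_derivative frechet_derivative f (at p)) (at p)"
  by (simp add: frechet_derivative_works)

lemma C_k_Suc_imp: "C_k (Suc k) f \<Longrightarrow> C_k k f"
proof (induction k arbitrary: f)
  case 0
  then show ?case
    by (auto intro!: differentiable_imp_continuous_on simp: differentiable_on_def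
        intro: differentiable_at_withinI)
next
  case (Suc k)
  then show ?case by (metis C_k.simps(2))
qed

lemma C_k_const: "C_k k (\<lambda>p. c)"
proof (induction k arbitrary: c)
  case (Suc k)
  show ?case by (rule C_k_SucI[where D = "\<lambda>p v. 0"]) (use Suc in auto)
qed auto

lemma C_k_bounded_linear:
  assumes "bounded_linear L" "C_k k f"
  shows "C_k k (\<lambda>p. L (f p))"
  using assms(2)
proof (induction k arbitrary: f)
  case 0
  then show ?case
    by (simp add: bounded_linear.continuous_on[OF assms(1)])
next
  case (Suc k)
  show ?case
  proof (rule C_k_SucI)
    show "((\<lambda>p. L (f p)) has_derivative (\<lambda>v. L (frechet_derivative f (at p) v))) (at p)" for p
      using bounded_linear.has_derivative[OF assms(1) C_k_Suc_has_derivative[OF Suc.prems]] .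
  qed (use Suc in auto)
qed

lemma C_k_add:
  assumes "C_k k f" "C_k k g"
  shows "C_k k (\<lambda>p. f p + g p)"
  using assms
proof (induction k arbitrary: f g)
  case (Suc k)
  show ?case
    by (rule C_k_SucI[OF has_derivative_add[OF C_k_Suc_has_derivative C_k_Suc_has_derivative]])
      (use Suc in auto)
qed (auto intro: continuous_on_add)

lemma C_k_Pair:
  assumes "C_k k f" "C_k k g"
  shows "C_k k (\<lambda>p. (f p, g p))"
  using assms
proof (induction k arbitrary: f g)
  case (Suc k)
  show ?case
    by (rule C_k_SucI[OF has_derivative_Pair[OF C_k_Suc_has_derivative C_k_Suc_has_derivative]])
      (use Suc in auto)
qed (auto intro: continuous_on_Pair)

lemma C_k_mult:
  fixes f g :: "'a::euclidean_space \<Rightarrow> real"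
  assumes "C_k k f" "C_k k g"
  shows "C_k k (\<lambda>p. f p * g p)"
  using assms
proof (induction k arbitrary: f g)
  case (Suc k)
  show ?case
  proof (rule C_k_SucI[OF has_derivative_mult[OF C_k_Suc_has_derivative C_k_Suc_has_derivative]])
    show "C_k k (\<lambda>p. f p * frechet_derivative g (at p) v + frechet_derivative f (at p) v * g p)" for v
      using Suc.prems C_k_Suc_imp[OF Suc.prems(1)] C_k_Suc_imp[OF Suc.prems(2)]
      by (intro C_k_add Suc.IH) auto
  qed (use Suc.prems in auto)
qed (auto intro: continuous_on_mult)

text \<open>A directional derivative is the constant \<open>l v\<close> times the derivative of
  \<open>F\<close> composed with the same affine map, so the induction runs over all
  \<open>F\<close>.\<close>

lemma C_k_compose_affine:
  fixes F :: "real \<Rightarrow> 'b::real_normed_vector" and l :: "'a::euclidean_space \<Rightarrow> real"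
  assumes "bounded_linear l" "C_k k F"
  shows "C_k k (\<lambda>p. F (c + l p))"
  using assms(2)
proof (induction k arbitrary: F)
  case 0
  then show ?case
    by (auto intro!: continuous_on_compose2[of UNIV F] continuous_intros
        bounded_linear.continuous_on[OF assms(1)])
next
  case (Suc k)
  show ?case
  proof (rule C_k_SucI)
    fix p
    have l: "((\<lambda>p. c + l p) has_derivative l) (at p)"
      using has_derivative_add[OF has_derivative_const bounded_linear_imp_has_derivative[OF assms(1)]]
      by simp
    have "((\<lambda>p. F (c + l p)) has_derivative (\<lambda>v. frechet_derivative F (at (c + l p)) (l v))) (at p)"
      using has_derivative_compose[OF l C_k_Suc_has_derivative[OF Suc.prems]] .
    moreover have "frechet_derivative F (at (c + l p)) (l v) = l v *\<^sub>R frechet_derivative F (at (c + l p)) 1" for v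
      using linear_cmul[OF has_derivative_linear[OF C_k_Suc_has_derivative[OF Suc.prems]], of _ "l v" 1]
      by simp
    ultimately show "((\<lambda>p. F (c + l p)) has_derivative
        (\<lambda>v. l v *\<^sub>R frechet_derivative F (at (c + l p)) 1)) (at p)" by simp
  next
    show "C_k k (\<lambda>p. l v *\<^sub>R frechet_derivative F (at (c + l p)) 1)" for v
      using Suc.prems Suc.IH[of "\<lambda>y. frechet_derivative F (at y) 1"]
      by (intro C_k_bounded_linear[OF bounded_linear_scaleR_right[of "l v"]]) simp
  qed
qed

text \<open>
  Closed under differentiation up to linear combinations, hence smooth.
\<close>

definition flat_exp :: "nat \<Rightarrow> real \<Rightarrow> real" where
  "flat_exp n y = (if y > 0 then (1/y) ^ n * exp (- 1/y) else 0)"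

lemma flat_exp_tendsto_0: "(flat_exp n \<longlongrightarrow> 0) (at 0)"
proof -
  have "((\<lambda>y. inverse y ^ n / exp (inverse y)) \<longlongrightarrow> 0) (at_right (0::real))"
    by (rule filterlim_compose[OF tendsto_power_div_exp_0 filterlim_inverse_at_top_right])
  then have "(flat_exp n \<longlongrightarrow> 0) (at_right 0)"
    by (rule Lim_transform_eventually)
      (auto simp: eventually_at_filter flat_exp_def exp_minus field_simps)
  moreover have "(flat_exp n \<longlongrightarrow> 0) (at_left 0)"
    by (rule Lim_transform_eventually[OF tendsto_const])
      (auto simp: eventually_at_filter flat_exp_def)
  ultimately show ?thesis
    by (simp add: filterlim_at_split)
qed

lemma flat_exp_has_derivative:
  "(flat_exp n has_real_derivative flat_exp (n + 2) y - n * flat_exp (n + 1) y) (at y)"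
proof -
  consider "y > 0" | "y < 0" | "y = 0" by linarith
  then show ?thesis
  proof cases
    case 1
    have inv: "((\<lambda>y. 1/y) has_real_derivative - ((1/y) * (1/y))) (at y)"
      "((\<lambda>y. exp (- 1/y)) has_real_derivative exp (- 1/y) * ((1/y) * (1/y))) (at y)"
      using 1 by (auto intro!: derivative_eq_intros)
    have "((\<lambda>y. (1/y) ^ n * exp (- 1/y)) has_real_derivative flat_exp (n + 2) y - n * flat_exp (n + 1) y) (at y)"
      by (rule DERIV_cong[OF DERIV_mult[OF DERIV_power[OF inv(1)] inv(2)]])
        (use 1 in \<open>cases n; simp add: flat_exp_def algebra_simps del: power_one_over power_divide\<close>)
    then show ?thesis
      by (rule has_field_derivative_transform_within_open[where S = "{0<..}"])
        (use 1 in \<open>auto simp: flat_exp_def\<close>)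
  next
    case 2
    have "((\<lambda>y. 0) has_real_derivative flat_exp (n + 2) y - n * flat_exp (n + 1) y) (at y)"
      using 2 by (auto simp: flat_exp_def)
    then show ?thesis
      by (rule has_field_derivative_transform_within_open[where S = "{..<0}"])
        (use 2 in \<open>auto simp: flat_exp_def\<close>)
  next
    case 3
    \<comment> \<open>The difference quotient at 0 is the next function of the family, also at
      \<open>h = 0\<close> because division by zero gives 0; its limit at 0 is 0.\<close>
    have "(\<lambda>h. (flat_exp n (0 + h) - flat_exp n 0) / h) = flat_exp (n + 1)"
      by (rule ext) (simp add: flat_exp_def)
    then show ?thesis
      using flat_exp_tendsto_0[of "n + 1"] by (simp add: 3 DERIV_def) (simp add: flat_exp_def)
  qed
qed

lemma smooth_flat_exp: "smooth (flat_exp n)"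
  unfolding smooth_def
proof
  fix k show "C_k k (flat_exp n)"
  proof (induction k arbitrary: n)
    case 0
    show ?case
      using DERIV_isCont[OF flat_exp_has_derivative] by (simp add: continuous_at_imp_continuous_on)
  next
    case (Suc k)
    show ?case
    proof (rule C_k_SucI[OF flat_exp_has_derivative[unfolded has_field_derivative_def]])
      show "C_k k (\<lambda>p. (flat_exp (n + 2) p - real n * flat_exp (n + 1) p) * v)" for v
        using C_k_add[OF Suc[of "n + 2"] C_k_mult[OF C_k_const[of k "- real n"] Suc[of "n + 1"]]]
        by (intro C_k_mult C_k_const) simp
    qed
  qed
qed

text \<open>The sequence consists of the iterated derivatives of one bump, so mixed partial
  derivatives of a product can be addressed by indices.\<close>

lemma exists_bump_derivatives:
  obtains F :: "nat \<Rightarrow> real \<Rightarrow> real" where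
    "\<And>n y. (F n has_real_derivative F (Suc n) y) (at y)" "\<And>n. smooth (F n)"
    "\<And>n y. y \<notin> {0..1} \<Longrightarrow> F n y = 0" "\<And>n. \<exists>y. F n y \<noteq> 0"
proof -
  define F0 where "F0 y = flat_exp 0 y * flat_exp 0 (1 - y)" for y
  define F where "F n = ((\<lambda>f y. frechet_derivative f (at y) 1) ^^ n) F0" for n
  have FSuc: "F (Suc n) = (\<lambda>y. frechet_derivative (F n) (at y) 1)" for n
    by (simp add: F_def)
  have smooth: "smooth (F n)" for n
  proof (induction n)
    case 0
    have "C_k k (\<lambda>y. flat_exp 0 (1 + - y))" for k
      using smooth_flat_exp by (intro C_k_compose_affine bounded_linear_minus bounded_linear_ident) (simp add: smooth_def)
    moreover have "F 0 = (\<lambda>y. flat_exp 0 y * flat_exp 0 (1 + - y))"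
      by (simp add: fun_eq_iff F_def F0_def)
    ultimately show ?case
      using smooth_flat_exp[of 0] unfolding smooth_def by (auto intro: C_k_mult)
  next
    case (Suc n)
    then have "C_k (Suc k) (F n)" for k unfolding smooth_def by blast
    then show ?case by (simp add: smooth_def FSuc)
  qed
  have deriv: "(F n has_real_derivative F (Suc n) y) (at y)" for n y
  proof -
    have "C_k (Suc 0) (F n)" using smooth unfolding smooth_def by blast
    then have d: "(F n has_derivative frechet_derivative (F n) (at y)) (at y)"
      by (rule C_k_Suc_has_derivative)
    have "frechet_derivative (F n) (at y) = (*) (F (Suc n) y)"
    proof
      fix v
      show "frechet_derivative (F n) (at y) v = F (Suc n) y * v"
        using linear_cmul[OF has_derivative_linear[OF d], of v 1] by (simp add: FSuc)
    qed
    then show ?thesis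
      using d by (simp add: has_field_derivative_def)
  qed
  have supp: "y \<notin> {0..1} \<Longrightarrow> F n y = 0" for n y
  proof (induction n arbitrary: y)
    case 0
    then show ?case by (auto simp: F_def F0_def flat_exp_def)
  next
    case (Suc n)
    have "((\<lambda>y. 0) has_real_derivative F (Suc n) y) (at y)"
      by (rule has_field_derivative_transform_within_open[OF deriv[of n], where S = "- {0..1}"])
        (use Suc in auto)
    then show ?case
      using DERIV_unique[OF _ DERIV_const] by blast
  qed
  have "\<exists>y. F n y \<noteq> 0" for n
  proof (induction n)
    case 0
    show ?case by (rule exI[of _ "1/2"]) (simp add: F_def F0_def flat_exp_def)
  next
    case (Suc n)
    show ?case
    \<comment> \<open>A vanishing next derivative would make \<open>F n\<close> constant, with the
      value 0 that it takes at 2, outside the support.\<close>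
    proof (rule ccontr)
      assume "\<not> ?thesis"
      then have "\<And>y. (F n has_real_derivative 0) (at y)" using deriv[of n] by metis
      then have "F n y = F n 2" for y by (metis DERIV_isconst_all)
      then show False using Suc supp[of 2 n] by auto
    qed
  qed
  then show ?thesis using that[of F] deriv smooth supp by blast
qed

section \<open>The field built from a product of bumps\<close>

definition tensor_fun :: "(nat \<Rightarrow> real \<Rightarrow> real) \<Rightarrow> nat \<Rightarrow> nat \<Rightarrow> nat \<Rightarrow> nat \<Rightarrow> spacetime \<Rightarrow> real" where
  "tensor_fun F i j k l p = F i (fst p $ 1) * (F j (fst p $ 2) * (F k (fst p $ 3) * F l (snd p)))"

lemma smooth_tensor_fun:
  assumes "\<And>n. smooth (F n)"
  shows "C_k m (tensor_fun F i j k l)"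
proof -
  have *: "C_k m (\<lambda>p. F n (L p))" if "bounded_linear L" for L :: "spacetime \<Rightarrow> real" and n
    using C_k_compose_affine[OF that, of m "F n" 0] assms by (simp add: smooth_def)
  have nth: "bounded_linear (\<lambda>p :: spacetime. fst p $ i)" for i
    by (rule bounded_linear_compose[OF bounded_linear_vec_nth bounded_linear_fst])
  show ?thesis
    unfolding tensor_fun_def by (intro C_k_mult * nth bounded_linear_snd)
qed

text \<open>When \<open>F\<close> lists successive derivatives, the indices count the derivatives in
  \<open>x1\<close>, \<open>x2\<close>, \<open>x3\<close> and \<open>t\<close> of a product bump, so
  each partial derivative raises one index.\<close>

lemma has_derivative_tensor_fun:
  assumes "\<And>n y. (F n has_real_derivative F (Suc n) y) (at y)"
  shows "(tensor_fun F i j k l has_derivative (\<lambda>v.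
      fst v $ 1 * tensor_fun F (Suc i) j k l p + fst v $ 2 * tensor_fun F i (Suc j) k l p +
      fst v $ 3 * tensor_fun F i j (Suc k) l p + snd v * tensor_fun F i j k (Suc l) p)) (at p)"
proof -
  have *: "((\<lambda>p. F n (L p)) has_derivative (\<lambda>v. F (Suc n) (L p) * L v)) (at p)"
    if "bounded_linear L" for L :: "spacetime \<Rightarrow> real" and n
    using has_derivative_compose[OF bounded_linear.has_derivative[OF that has_derivative_ident]
        assms[of n, unfolded has_field_derivative_def]] .
  have nth: "bounded_linear (\<lambda>p :: spacetime. fst p $ i)" for i
    by (rule bounded_linear_compose[OF bounded_linear_vec_nth bounded_linear_fst])
  show ?thesis
    unfolding tensor_fun_def
    by (rule has_derivative_eq_rhs[OF has_derivative_mult[OF *[OF nth] has_derivative_mult[OF *[OF nth]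
            has_derivative_mult[OF *[OF nth] *[OF bounded_linear_snd]]]]])
      (simp add: fun_eq_iff algebra_simps)
qed

text \<open>With \<open>g\<close> the product bump, \<open>u\<close> has stream function
  \<open>\<partial>\<^sub>1\<partial>\<^sub>2 g\<close> and \<open>b\<close> is the curl of
  \<open>(g, 0, 0)\<close>, so both are divergence free; \<open>a\<close> is minus the time
  derivative of that potential. The factor \<open>\<kappa>\<close> anticipates the final
  scaling.\<close>

lemma exists_compact_MHD_field:
  obtains u b S a where
    "smooth (\<lambda>p. (u p, b p, S p, a p))" "compact_support (\<lambda>p. (u p, b p, S p, a p))"
    "\<And>p. symmetric_matrix (S p)" "\<And>p. a p \<bullet> b p = 0" "\<exists>p. u p \<noteq> 0" "\<exists>p. b p \<noteq> 0"
    "\<And>\<kappa>. linear_MHD (\<lambda>p. \<kappa> *\<^sub>R u p) (\<lambda>p. \<kappa> *\<^sub>R b p) (\<lambda>p. \<kappa> *\<^sub>R S p) (\<lambda>p. \<kappa> *\<^sub>R a p)"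
proof -
  obtain F :: "nat \<Rightarrow> real \<Rightarrow> real" where
    F: "\<And>n y. (F n has_real_derivative F (Suc n) y) (at y)" "\<And>n. smooth (F n)"
    "\<And>n y. y \<notin> {0..1} \<Longrightarrow> F n y = 0" "\<And>n. \<exists>y. F n y \<noteq> 0"
    using exists_bump_derivatives by blast
  define G where "G = tensor_fun F"
  define e :: "3 \<Rightarrow> real^3" where "e i = axis i 1" for i
  define u where "u p = G 1 2 0 0 p *\<^sub>R e 1 + (- G 2 1 0 0 p) *\<^sub>R e 2" for p
  define b where "b p = G 0 0 1 0 p *\<^sub>R e 2 + (- G 0 1 0 0 p) *\<^sub>R e 3" for p
  define S where "S p = (- G 0 2 0 1 p) *\<^sub>R (e 1 \<otimes> e 1) + G 2 0 0 1 p *\<^sub>R (e 2 \<otimes> e 2)" for p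
  define a where "a p = (- G 0 0 0 1 p) *\<^sub>R e 1" for p
  have e_nth: "e i $ j = (if i = j then 1 else 0)" for i j
    by (simp add: e_def axis_def)
  have ne: "(1::3) \<noteq> 2" "(1::3) \<noteq> 3" "(2::3) \<noteq> 3" "(2::3) \<noteq> 1" "(3::3) \<noteq> 1" "(3::3) \<noteq> 2"
    by auto
  define G' where "G' i j k l p v = fst v $ 1 * G (Suc i) j k l p + fst v $ 2 * G i (Suc j) k l p +
      fst v $ 3 * G i j (Suc k) l p + snd v * G i j k (Suc l) p" for i j k l p and v :: spacetime
  have dG: "(G i j k l has_derivative G' i j k l p) (at p)" for i j k l p
    using has_derivative_tensor_fun[of F i j k l p] F(1) unfolding G_def[symmetric] G'_def by blast
  have dcG: "((\<lambda>q. c * G i j k l q) has_derivative (\<lambda>v. c * G' i j k l p v)) (at p)" for c i j k l p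
    by (rule has_derivative_mult_right[OF dG])
  have fG: "frechet_derivative (\<lambda>q. c * G i j k l q) (at p) = (\<lambda>v. c * G' i j k l p v)" for c i j k l p
    using frechet_derivative_at[OF dcG] by metis
  have G'e: "G' i j k l p (axis 1 1, 0) = G (Suc i) j k l p" "G' i j k l p (axis 2 1, 0) = G i (Suc j) k l p"
    "G' i j k l p (axis 3 1, 0) = G i j (Suc k) l p" "G' i j k l p (0, 1) = G i j k (Suc l) p" for i j k l p
    by (simp_all add: G'_def axis_def)
  have fconst: "frechet_derivative (\<lambda>q :: spacetime. 0 :: real) (at p) = (\<lambda>v. 0)" for p
    by (simp add: frechet_derivative_const)
  have dtu: "dt (\<lambda>p. \<kappa> *\<^sub>R u p) p = (\<kappa> * G 1 2 0 1 p) *\<^sub>R e 1 + (- \<kappa> * G 2 1 0 1 p) *\<^sub>R e 2" for \<kappa> p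
  proof -
    have "((\<lambda>p. (\<kappa> * G 1 2 0 0 p) *\<^sub>R e 1 + (- \<kappa> * G 2 1 0 0 p) *\<^sub>R e 2) has_derivative
      (\<lambda>v. (\<kappa> * G' 1 2 0 0 p v) *\<^sub>R e 1 + (- \<kappa> * G' 2 1 0 0 p v) *\<^sub>R e 2)) (at p)"
      by (intro has_derivative_add has_derivative_scaleR_left dcG)
    moreover have "(\<lambda>p. (\<kappa> * G 1 2 0 0 p) *\<^sub>R e 1 + (- \<kappa> * G 2 1 0 0 p) *\<^sub>R e 2) = (\<lambda>p. \<kappa> *\<^sub>R u p)"
      by (simp add: u_def scaleR_add_right scaleR_diff_right)
    ultimately show ?thesis
      unfolding dt_def by (simp add: frechet_derivative_at[symmetric] G'e)
  qed
  have dtb: "dt (\<lambda>p. \<kappa> *\<^sub>R b p) p = (\<kappa> * G 0 0 1 1 p) *\<^sub>R e 2 + (- \<kappa> * G 0 1 0 1 p) *\<^sub>R e 3" for \<kappa> p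
  proof -
    have "((\<lambda>p. (\<kappa> * G 0 0 1 0 p) *\<^sub>R e 2 + (- \<kappa> * G 0 1 0 0 p) *\<^sub>R e 3) has_derivative
      (\<lambda>v. (\<kappa> * G' 0 0 1 0 p v) *\<^sub>R e 2 + (- \<kappa> * G' 0 1 0 0 p v) *\<^sub>R e 3)) (at p)"
      by (intro has_derivative_add has_derivative_scaleR_left dcG)
    moreover have "(\<lambda>p. (\<kappa> * G 0 0 1 0 p) *\<^sub>R e 2 + (- \<kappa> * G 0 1 0 0 p) *\<^sub>R e 3) = (\<lambda>p. \<kappa> *\<^sub>R b p)"
      by (simp add: b_def scaleR_add_right scaleR_diff_right)
    ultimately show ?thesis
      unfolding dt_def by (simp add: frechet_derivative_at[symmetric] G'e)
  qed
  \<comment> \<open>Every component is brought to the form constant times \<open>G\<close> or to 0,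
    the two shapes whose derivatives \<open>fG\<close> and \<open>fconst\<close> compute.\<close>
  have comp: "(\<lambda>p. (\<kappa> *\<^sub>R u p) $ 1) = (\<lambda>p. \<kappa> * G 1 2 0 0 p)" "(\<lambda>p. (\<kappa> *\<^sub>R u p) $ 2) = (\<lambda>p. - \<kappa> * G 2 1 0 0 p)"
    "(\<lambda>p. (\<kappa> *\<^sub>R u p) $ 3) = (\<lambda>p. 0)"
    "(\<lambda>p. (\<kappa> *\<^sub>R b p) $ 1) = (\<lambda>p. 0)" "(\<lambda>p. (\<kappa> *\<^sub>R b p) $ 2) = (\<lambda>p. \<kappa> * G 0 0 1 0 p)"
    "(\<lambda>p. (\<kappa> *\<^sub>R b p) $ 3) = (\<lambda>p. - \<kappa> * G 0 1 0 0 p)"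
    "(\<lambda>p. (\<kappa> *\<^sub>R a p) $ 1) = (\<lambda>p. - \<kappa> * G 0 0 0 1 p)" "(\<lambda>p. (\<kappa> *\<^sub>R a p) $ 2) = (\<lambda>p. 0)"
    "(\<lambda>p. (\<kappa> *\<^sub>R a p) $ 3) = (\<lambda>p. 0)"
    "(\<lambda>p. (\<kappa> *\<^sub>R S p) $ 1 $ 1) = (\<lambda>p. - \<kappa> * G 0 2 0 1 p)" "(\<lambda>p. (\<kappa> *\<^sub>R S p) $ 2 $ 2) = (\<lambda>p. \<kappa> * G 2 0 0 1 p)"
    "(\<lambda>p. (\<kappa> *\<^sub>R S p) $ 1 $ 2) = (\<lambda>p. 0)" "(\<lambda>p. (\<kappa> *\<^sub>R S p) $ 1 $ 3) = (\<lambda>p. 0)"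
    "(\<lambda>p. (\<kappa> *\<^sub>R S p) $ 2 $ 1) = (\<lambda>p. 0)" "(\<lambda>p. (\<kappa> *\<^sub>R S p) $ 2 $ 3) = (\<lambda>p. 0)"
    "(\<lambda>p. (\<kappa> *\<^sub>R S p) $ 3 $ 1) = (\<lambda>p. 0)" "(\<lambda>p. (\<kappa> *\<^sub>R S p) $ 3 $ 2) = (\<lambda>p. 0)"
    "(\<lambda>p. (\<kappa> *\<^sub>R S p) $ 3 $ 3) = (\<lambda>p. 0)" for \<kappa>
    by (simp_all add: u_def b_def S_def a_def e_nth tensor_def ne)
  have MHD: "linear_MHD (\<lambda>p. \<kappa> *\<^sub>R u p) (\<lambda>p. \<kappa> *\<^sub>R b p) (\<lambda>p. \<kappa> *\<^sub>R S p) (\<lambda>p. \<kappa> *\<^sub>R a p)" for \<kappa>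
    unfolding linear_MHD_def
  proof (intro allI conjI)
    fix p
    show "div_vec (\<lambda>p. \<kappa> *\<^sub>R u p) p = 0" "div_vec (\<lambda>p. \<kappa> *\<^sub>R b p) p = 0"
      by (simp_all only: div_vec_def sum_3 dx_def comp fG fconst G'e) (simp_all add: numeral_2_eq_2)
    show "dt (\<lambda>p. \<kappa> *\<^sub>R u p) p + div_mat (\<lambda>p. \<kappa> *\<^sub>R S p) p = 0"
      unfolding dtu vec_eq_iff forall_3 div_mat_def
      by (simp only: sum_3 dx_def comp fG fconst G'e vec_lambda_beta vector_add_component)
        (simp add: e_nth ne numeral_2_eq_2)
    show "dt (\<lambda>p. \<kappa> *\<^sub>R b p) p + curl (\<lambda>p. \<kappa> *\<^sub>R a p) p = 0"
      unfolding dtb vec_eq_iff forall_3 curl_def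
      by (simp only: dx_def comp fG fconst G'e vector_3 vector_add_component)
        (simp add: e_nth ne)
  qed
  have CG: "C_k m (G i j k l)" for m i j k l
    unfolding G_def by (rule smooth_tensor_fun[OF F(2)])
  have Cs: "C_k m (\<lambda>p. G i j k l p *\<^sub>R w)" "C_k m (\<lambda>p. (- G i j k l p) *\<^sub>R w)"
    for m i j k l and w :: "'c::real_normed_vector"
    using C_k_bounded_linear[OF bounded_linear_scaleR_left[of w] CG]
      C_k_bounded_linear[OF bounded_linear_minus[OF bounded_linear_scaleR_left[of w]] CG] by auto
  have smooth: "smooth (\<lambda>p. (u p, b p, S p, a p))"
    unfolding smooth_def u_def b_def S_def a_def by (intro allI C_k_Pair C_k_add Cs)
  define B :: "spacetime set" where "B = cbox 0 (\<chi> i. 1) \<times> {0..1}"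
  have G0: "G i j k l p = 0" if "p \<notin> B" for i j k l p
    using that F(3) by (auto simp: B_def G_def tensor_fun_def mem_Times_iff mem_box_cart forall_3)
  have "(u p, b p, S p, a p) = 0" if "p \<notin> B" for p
    by (simp add: u_def b_def S_def a_def zero_prod_def G0[OF that])
  then have "{p. (u p, b p, S p, a p) \<noteq> 0} \<subseteq> B"
    by blast
  moreover have "compact B"
    unfolding B_def by (intro compact_Times compact_cbox compact_Icc)
  ultimately have "compact (closure {p. (u p, b p, S p, a p) \<noteq> 0})"
    unfolding compact_closure by (rule bounded_subset[OF compact_imp_bounded, rotated])
  then have supp: "compact_support (\<lambda>p. (u p, b p, S p, a p))"
    by (simp add: compact_support_def)
  have nz: "\<exists>p. G i j k l p \<noteq> 0" for i j k l
  proof -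
    obtain x y z t where "F i x \<noteq> 0" "F j y \<noteq> 0" "F k z \<noteq> 0" "F l t \<noteq> 0" using F(4) by metis
    then show ?thesis
      by (intro exI[of _ "(vector [x, y, z], t)"]) (simp add: G_def tensor_fun_def vector_3)
  qed
  have "\<exists>p. u p \<noteq> 0"
  proof -
    obtain p where "G 1 2 0 0 p \<noteq> 0" using nz by blast
    then have "u p $ 1 \<noteq> 0" by (simp add: u_def e_nth ne)
    then show ?thesis by (metis zero_index)
  qed
  moreover have "\<exists>p. b p \<noteq> 0"
  proof -
    obtain p where "G 0 0 1 0 p \<noteq> 0" using nz by blast
    then have "b p $ 2 \<noteq> 0" by (simp add: b_def e_nth ne)
    then show ?thesis by (metis zero_index)
  qed
  moreover have "symmetric_matrix (S p)" for p
    by (simp add: symmetric_matrix_def S_def transpose_def tensor_def vec_eq_iff mult.commute)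
  moreover have "a p \<bullet> b p = 0" for p
    by (simp add: a_def b_def inner_simps e_def inner_axis_axis)
  ultimately show ?thesis
    using that[of u b S a] smooth supp MHD by blast
qed

section \<open>Scaling the field into the neighbourhood of zero\<close>

theorem theorem1p5:
  fixes r s :: real
  assumes "r > 0" and "s > 0"
  shows "\<exists>(u :: (real^3) \<times> real \<Rightarrow> real^3) (b :: (real^3) \<times> real \<Rightarrow> real^3)
          (S :: (real^3) \<times> real \<Rightarrow> real^3^3) (a :: (real^3) \<times> real \<Rightarrow> real^3).
           smooth (\<lambda>p. (u p, b p, S p, a p)) \<and>
           compact_support (\<lambda>p. (u p, b p, S p, a p)) \<and>
           (\<forall>p. symmetric_matrix (S p)) \<and>
           (\<exists>p. u p \<noteq> 0) \<and> (\<exists>p. b p \<noteq> 0) \<and>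
           strict_subsolution r s u b S a"
proof -
  obtain \<delta> where \<delta>: "\<delta> > 0" and U: "\<And>u b S a. symmetric_matrix S \<Longrightarrow> a \<bullet> b = 0 \<Longrightarrow>
      norm (u, b, S, a) < \<delta> \<Longrightarrow> (u, b, S, a) \<in> U_set r s"
    using U_set_near_zero[OF assms] by blast
  obtain u b :: "spacetime \<Rightarrow> real^3" and S a where
    V: "smooth (\<lambda>p. (u p, b p, S p, a p))" "compact_support (\<lambda>p. (u p, b p, S p, a p))"
    and Sa: "\<And>p. symmetric_matrix (S p)" "\<And>p. a p \<bullet> b p = 0"
    and nz: "\<exists>p. u p \<noteq> 0" "\<exists>p. b p \<noteq> 0"
    and MHD: "\<And>\<kappa>. linear_MHD (\<lambda>p. \<kappa> *\<^sub>R u p) (\<lambda>p. \<kappa> *\<^sub>R b p) (\<lambda>p. \<kappa> *\<^sub>R S p) (\<lambda>p. \<kappa> *\<^sub>R a p)"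
    using exists_compact_MHD_field by blast
  define V where "V p = (u p, b p, S p, a p)" for p
  obtain M where M: "M > 0" "\<And>p. norm (V p) \<le> M"
  proof -
    have "C_k 0 V"
      using V(1) unfolding smooth_def V_def by blast
    then have "bounded (V ` closure {p. V p \<noteq> 0})"
      using V(2) unfolding compact_support_def V_def[symmetric]
      by (auto intro!: compact_imp_bounded compact_continuous_image intro: continuous_on_subset)
    then obtain M where M: "M > 0" "\<And>p. p \<in> closure {p. V p \<noteq> 0} \<Longrightarrow> norm (V p) \<le> M"
      unfolding bounded_pos by auto
    have "norm (V p) \<le> M" for p
    proof (cases "V p = 0")
      case False
      then show ?thesis using M(2) closure_subset[of "{p. V p \<noteq> 0}"] by blast
    qed (use M in simp)
    with M(1) show ?thesis by (rule that)
  qed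
  \<comment> \<open>The factor 2 makes the bound strict: \<open>\<kappa> * M\<close> is half of
    \<open>\<delta>\<close>.\<close>
  define \<kappa> where "\<kappa> = \<delta> / (2 * M)"
  have \<kappa>: "\<kappa> > 0" using \<delta> M by (simp add: \<kappa>_def)
  \<comment> \<open>Membership holds at every point, also off the support where the state is 0,
    which settles the almost-everywhere condition.\<close>
  have in_U: "(\<kappa> *\<^sub>R u p, \<kappa> *\<^sub>R b p, \<kappa> *\<^sub>R S p, \<kappa> *\<^sub>R a p) \<in> U_set r s" for p
  proof (rule U)
    have "norm (\<kappa> *\<^sub>R V p) \<le> \<kappa> * M"
      using \<kappa> M(2)[of p] by simp
    also have "\<kappa> * M < \<delta>"
      using \<delta> M by (simp add: \<kappa>_def)
    finally show "norm (\<kappa> *\<^sub>R u p, \<kappa> *\<^sub>R b p, \<kappa> *\<^sub>R S p, \<kappa> *\<^sub>R a p) < \<delta>"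
      by (simp add: V_def)
  qed (use Sa[of p] in \<open>auto simp: symmetric_simps\<close>)
  have \<kappa>V: "(\<lambda>p. (\<kappa> *\<^sub>R u p, \<kappa> *\<^sub>R b p, \<kappa> *\<^sub>R S p, \<kappa> *\<^sub>R a p)) = (\<lambda>p. \<kappa> *\<^sub>R V p)"
    by (simp add: V_def)
  have "smooth (\<lambda>p. \<kappa> *\<^sub>R V p)"
    using V(1) unfolding smooth_def V_def[symmetric]
    by (auto intro: C_k_bounded_linear[OF bounded_linear_scaleR_right])
  moreover have "compact_support (\<lambda>p. \<kappa> *\<^sub>R V p)"
    using V(2) \<kappa> unfolding compact_support_def V_def[symmetric] by simp
  moreover have "\<forall>p. symmetric_matrix (\<kappa> *\<^sub>R S p)"
    using Sa(1) by (simp add: symmetric_simps)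
  moreover have "\<exists>p. \<kappa> *\<^sub>R u p \<noteq> 0" "\<exists>p. \<kappa> *\<^sub>R b p \<noteq> 0"
    using nz \<kappa> by auto
  moreover have "strict_subsolution r s (\<lambda>p. \<kappa> *\<^sub>R u p) (\<lambda>p. \<kappa> *\<^sub>R b p) (\<lambda>p. \<kappa> *\<^sub>R S p) (\<lambda>p. \<kappa> *\<^sub>R a p)"
    using MHD in_U by (simp add: strict_subsolution_def)
  ultimately show ?thesis
    unfolding \<kappa>V[symmetric]
    by (intro exI[of _ "\<lambda>p. \<kappa> *\<^sub>R u p"] exI[of _ "\<lambda>p. \<kappa> *\<^sub>R b p"]
        exI[of _ "\<lambda>p. \<kappa> *\<^sub>R S p"] exI[of _ "\<lambda>p. \<kappa> *\<^sub>R a p"] conjI)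
qed

end
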